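(* Fix $n\ge1$. Partition the set of 3-periodic dissections of the convex $(n+2)$-gon into classes of dissections having the same quiddity. Every such class contains exactly one maximally open 3-periodic dissection.
   Context: Fix a convex $(n+2)$-gon with vertices labelled $0,1,\dots,n+1$ in counterclockwise cyclic order; its edges are $(i,i+1)$, $i\in\mathbb Z/(n+2)$, and its base edge is $(n+1,0)$. A dissection is a set of pairwise non-crossing diagonals (chords), partitioning the polygon into cells; the sides of a cell are the edges and chords bounding it. The quiddity of a dissection is $(a_0,\dots,a_{n+1})$ with $a_i$ the number of cells having vertex $i$. A dissection is 3-periodic if every cell has a number of vertices divisible by 3. The base cell is the cell containing the base edge. For a cell with vertices $0\le v_0<\dots<v_{r+1}\le n+1$, its sides are $(v_s,v_{s+1})$, $0\le s\le r+1$, with $v_{r+2}:=v_0$, and its base side is $(v_{r+1},v_0)$. The parent of a non-base cell is the other cell containing its base side; the level of a cell is its number of iterated parents. $\mathbb Z_3$-index: recursively on level, the base edge has index $0$, and if a cell's base side has index $c$ then its side $(v_s,v_{s+1})$ has index $c+s+1\bmod3$ for $0\le s\le r$. Sides $(v_s,v_{s+1}),(v_{s'},v_{s'+1})$, $s<s'$, of a cell are distant if $s'\ge s+3$ and $s\ge s'+3-(r+2)$. A 3-periodic opening surgery on a cell is the replacement of its base side and another side distant from it, both being chords of the same $\mathbb Z_3$-index, say $(v_s,v_{s+1})$ and $(v_{s'},v_{s'+1})$, by the chords $(v_{s+1},v_{s'})$ and $(v_{s'+1},v_s)$. A cell is maximally open if it admits no 3-periodic opening surgery; a 3-periodic dissection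 is maximally open if all its cells are. *)

theory Defs
  imports Main
begin

text \<open>Throughout, the polygon is the convex \<open>(n + 2)\<close>-gon with vertices \<open>0, \<dots>, n + 1\<close>;
  edges and chords are unordered pairs of vertices, represented as two-element sets.\<close>

definition polygon_edges :: "nat \<Rightarrow> nat set set" where
  "polygon_edges n = {{i, (i + 1) mod (n + 2)} | i. i < n + 2}"

definition base_edge :: "nat \<Rightarrow> nat set" where
  "base_edge n = {n + 1, 0}"

definition diagonals :: "nat \<Rightarrow> nat set set" where
  "diagonals n = {{i, j} | i j. i < n + 2 \<and> j < n + 2 \<and> i \<noteq> j} - polygon_edges n"

definition crossing :: "nat set \<Rightarrow> nat set \<Rightarrow> bool" where
  "crossing d e \<longleftrightarrow>
     (\<exists>i j k l. i < j \<and> j < k \<and> k < l \<and>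
        (d = {i, k} \<and> e = {j, l} \<or> d = {j, l} \<and> e = {i, k}))"

definition dissections :: "nat \<Rightarrow> nat set set set" where
  "dissections n = {D. D \<subseteq> diagonals n \<and> (\<forall>d\<in>D. \<forall>e\<in>D. \<not> crossing d e)}"

text \<open>A cell is represented by its set \<open>V\<close> of vertices; with \<open>v\<^sub>0 < \<dots> < v\<^sub>r\<^sub>+\<^sub>1\<close> the increasing
  enumeration of \<open>V\<close> we have \<open>r + 2 = card V\<close>, and \<open>vtx V s\<close> is \<open>v\<^sub>s\<close>, read cyclically
  so that \<open>v\<^sub>r\<^sub>+\<^sub>2 = v\<^sub>0\<close>.\<close>

definition vtx :: "nat set \<Rightarrow> nat \<Rightarrow> nat" where
  "vtx V s = sorted_list_of_set V ! (s mod card V)"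

definition side :: "nat set \<Rightarrow> nat \<Rightarrow> nat set" where
  "side V s = {vtx V s, vtx V (s + 1)}"

definition sides :: "nat set \<Rightarrow> nat set set" where
  "sides V = {side V s | s. s < card V}"

definition base_side :: "nat set \<Rightarrow> nat set" where
  "base_side V = side V (card V - 1)"

text \<open>The cells are the sub-polygons bounded by edges and chords of the dissection which no chord
  of the dissection cuts. As the chords do not cross, a chord meeting the interior of such a
  sub-polygon would have to join two of its vertices without being one of its sides.\<close>

definition cells :: "nat \<Rightarrow> nat set set \<Rightarrow> nat set set" where
  "cells n D = {V. V \<subseteq> {0..n + 1} \<and> card V \<ge> 3 \<and>
     sides V \<subseteq> polygon_edges n \<union> D \<and>
     (\<forall>d\<in>D. d \<subseteq> V \<longrightarrow> d \<in> sides V)}"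

definition quiddity :: "nat \<Rightarrow> nat set set \<Rightarrow> nat list" where
  "quiddity n D = map (\<lambda>i. card {V \<in> cells n D. i \<in> V}) [0..<n + 2]"

definition three_periodic_dissections :: "nat \<Rightarrow> nat set set set" where
  "three_periodic_dissections n = {D \<in> dissections n. \<forall>V\<in>cells n D. 3 dvd card V}"

text \<open>\<open>z3_index n D e c\<close> says that \<open>e\<close>, the base edge or a side of a cell, has index \<open>c\<close>.
  The base side of a non-base cell is a side, other than the base side, of exactly one further
  cell (its parent), so recursion on the level of cells is rule induction here.\<close>

inductive z3_index :: "nat \<Rightarrow> nat set set \<Rightarrow> nat set \<Rightarrow> nat \<Rightarrow> bool" for n D where
  base: "z3_index n D (base_edge n) 0"
| side: "\<lbrakk>V \<in> cells n D; z3_index n D (base_side V) c; s + 1 < card V\<rbrakk>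
         \<Longrightarrow> z3_index n D (side V s) ((c + s + 1) mod 3)"

definition distant :: "nat set \<Rightarrow> nat \<Rightarrow> nat \<Rightarrow> bool" where
  "distant V s s' \<longleftrightarrow>
     s < s' \<and> s' < card V \<and> s' \<ge> s + 3 \<and> int s \<ge> int s' + 3 - int (card V)"

text \<open>The base side of \<open>V\<close> is \<open>side V s'\<close> with \<open>s' = card V - 1\<close>, so any other side comes
  before it in the numbering.\<close>

definition opening_surgery ::
    "nat \<Rightarrow> nat set set \<Rightarrow> nat set \<Rightarrow> nat set set \<Rightarrow> bool" where
  "opening_surgery n D V D' \<longleftrightarrow>
     (\<exists>s s' c. s' = card V - 1 \<and> distant V s s' \<and>
        side V s \<in> D \<and> side V s' \<in> D \<and>
        z3_index n D (side V s) c \<and> z3_index n D (side V s') c \<and>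
        D' = (D - {side V s, side V s'}) \<union>
             {{vtx V (s + 1), vtx V s'}, {vtx V (s' + 1), vtx V s}})"

definition maximally_open_cell :: "nat \<Rightarrow> nat set set \<Rightarrow> nat set \<Rightarrow> bool" where
  "maximally_open_cell n D V \<longleftrightarrow> \<not> (\<exists>D'. opening_surgery n D V D')"

definition maximally_open :: "nat \<Rightarrow> nat set set \<Rightarrow> bool" where
  "maximally_open n D \<longleftrightarrow> (\<forall>V\<in>cells n D. maximally_open_cell n D V)"

definition same_quiddity :: "nat \<Rightarrow> (nat set set \<times> nat set set) set" where
  "same_quiddity n = {(D, D'). D \<in> three_periodic_dissections n \<and>
     D' \<in> three_periodic_dissections n \<and> quiddity n D = quiddity n D'}"

end

theory Submission
  imports Defs
begin

text \<open>The number of cells at a vertex exceeds the number of chords at it by one, so dissections have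
  the same quiddity iff their chords have the same degrees. In a cell of a 3-periodic dissection
  the sides with the index of the base side are those at positions \<open>s \<equiv> 2 (mod 3)\<close>, and all of
  them are distant from it.

  Existence: an opening surgery preserves degrees and 3-periodicity and decreases the sum of the
  lengths \<open>j - i\<close> of the chords \<open>{i, j}\<close>, so a dissection minimising this sum in its class is
  maximally open. Uniqueness: read the chord ends vertex by vertex, each one either closing the
  innermost open chord or opening a new one. In a maximally open dissection an end that can close
  the innermost open chord (they have the same index) must do so, hence the degrees determine all
  choices.\<close>

section \<open>Vertices and sides of a cell\<close>

text \<open>Positions in the enumeration of a cell are awkward to compare between cells, so most
  arguments use order only: a side is a consecutive pair (\<open>consec\<close>) or the base side
  \<open>{Min V, Max V}\<close>, and a cell is recovered from its base side by
  \<open>cell_below\<close>. The obstacle to existence is that a surgery merges and splits cells,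
  and checking 3-periodicity directly would mean identifying every new cell. Hence 3-periodicity is
  rewritten as congruences on numbers of chords (\<open>three_periodic_iff\<close>) that mention no
  cells; for the new chords they reduce to counting sides along an arc of the old cell. The indices
  of the new dissection are never computed. The distance condition is automatic because both
  \<open>s + 1\<close> and the size of the cell are multiples of 3, which leaves at least three
  vertices on each of the two arcs. Uniqueness rests on the fact that the size of a cell closed in
  one dissection is the position of a vertex in a cell of the other, so divisibility by 3 there
  becomes equality of indices here.\<close>

definition consec :: "nat set \<Rightarrow> nat \<Rightarrow> nat \<Rightarrow> bool" where
  "consec V a b \<longleftrightarrow> a \<in> V \<and> b \<in> V \<and> a < b \<and> (\<forall>x\<in>V. \<not> (a < x \<and> x < b))"

lemma vtx_less:
  assumes "finite V" "s < t" "t < card V"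
  shows "vtx V s < vtx V t"
proof -
  have "sorted_wrt (<) (sorted_list_of_set V)" "length (sorted_list_of_set V) = card V"
    using assms by simp_all
  then show ?thesis
    using assms by (simp add: vtx_def sorted_wrt_nth_less)
qed

lemma vtx_in:
  assumes "finite V" "s < card V"
  shows "vtx V s \<in> V"
proof -
  have "sorted_list_of_set V ! s \<in> set (sorted_list_of_set V)"
    using assms by (intro nth_mem) simp
  then show ?thesis
    using assms by (simp add: vtx_def)
qed

lemma vtx_surj:
  assumes "finite V" "x \<in> V"
  obtains s where "s < card V" "vtx V s = x"
proof -
  have "x \<in> set (sorted_list_of_set V)"
    using assms by simp
  then obtain s where "s < length (sorted_list_of_set V)" "sorted_list_of_set V ! s = x"
    by (metis in_set_conv_nth)
  then show ?thesis
    using assms that[of s] by (simp add: vtx_def)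
qed

lemma vtx_less_iff:
  assumes "finite V" "s < card V" "t < card V"
  shows "vtx V s < vtx V t \<longleftrightarrow> s < t"
  using assms vtx_less[of V s t] vtx_less[of V t s] by (metis less_asym less_irrefl linorder_neqE_nat)

text \<open>Recovers the position of a vertex from the set alone; this makes positions comparable
  between cells.\<close>

lemma card_below_vtx:
  assumes "finite V" "s < card V"
  shows "card {x \<in> V. x < vtx V s} = s"
proof -
  have "{x \<in> V. x < vtx V s} = vtx V ` {..<s}"
  proof (intro set_eqI iffI)
    fix x assume x: "x \<in> {x \<in> V. x < vtx V s}"
    then obtain t where "t < card V" "vtx V t = x"
      using assms vtx_surj by blast
    with x show "x \<in> vtx V ` {..<s}"
      using assms by (auto simp: vtx_less_iff)
  next
    fix x assume "x \<in> vtx V ` {..<s}"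
    then show "x \<in> {x \<in> V. x < vtx V s}"
      using assms by (auto simp: vtx_less_iff intro!: vtx_in)
  qed
  moreover have "inj_on (vtx V) {..<s}"
  proof (rule linorder_inj_onI)
    fix t u assume "t < u" "t \<in> {..<s}" "u \<in> {..<s}"
    then show "vtx V t \<noteq> vtx V u"
      using assms vtx_less[of V t u] by simp
  qed auto
  ultimately show ?thesis
    by (simp add: card_image)
qed

lemma vtx_0:
  assumes "finite V" "V \<noteq> {}"
  shows "vtx V 0 = Min V"
proof (rule sym, rule Min_eqI)
  show "vtx V 0 \<in> V"
    using assms by (simp add: vtx_in card_gt_0_iff)
  show "vtx V 0 \<le> y" if "y \<in> V" for y
    using vtx_surj[OF assms(1) that] vtx_less[OF assms(1), of 0]
    by (metis gr0I less_imp_le order_refl)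
qed (use assms in simp)

lemma vtx_last:
  assumes "finite V" "V \<noteq> {}"
  shows "vtx V (card V - 1) = Max V"
proof (rule sym, rule Max_eqI)
  have 0: "0 < card V"
    using assms by (simp add: card_gt_0_iff)
  then show "vtx V (card V - 1) \<in> V"
    using assms by (simp add: vtx_in)
  show "y \<le> vtx V (card V - 1)" if y: "y \<in> V" for y
  proof -
    obtain s where s: "s < card V" "vtx V s = y"
      using vtx_surj[OF assms(1) y] .
    show ?thesis
    proof (cases "s = card V - 1")
      case False
      then show ?thesis
        using s vtx_less[OF assms(1), of s "card V - 1"] by fastforce
    qed (use s in simp)
  qed
qed (use assms in simp)

lemma vtx_card [simp]: "vtx V (card V) = vtx V 0"
  by (simp add: vtx_def)

lemma consec_vtx:
  assumes "finite V" "s + 1 < card V"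
  shows "consec V (vtx V s) (vtx V (s + 1))"
proof -
  have "\<not> (vtx V s < x \<and> x < vtx V (s + 1))" if x: "x \<in> V" for x
  proof -
    obtain t where "t < card V" "vtx V t = x"
      using vtx_surj[OF assms(1) x] .
    then show ?thesis
      using assms vtx_less_iff[of V s t] vtx_less_iff[of V t "s + 1"] by auto
  qed
  then show ?thesis
    using assms by (auto simp: consec_def vtx_in intro: vtx_less)
qed

lemma consec_imp_vtx:
  assumes "finite V" "consec V a b"
  obtains s where "s + 1 < card V" "a = vtx V s" "b = vtx V (s + 1)"
proof -
  obtain s where s: "s < card V" "vtx V s = a"
    using assms vtx_surj unfolding consec_def by metis
  obtain t where t: "t < card V" "vtx V t = b"
    using assms vtx_surj unfolding consec_def by metis
  have "s < t"
    using s t assms vtx_less_iff unfolding consec_def by metis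
  moreover have "\<not> s + 1 < t"
  proof
    assume "s + 1 < t"
    then have "vtx V (s + 1) \<in> V" "a < vtx V (s + 1)" "vtx V (s + 1) < b"
      using s t assms(1) vtx_less[of V s "s + 1"] vtx_less[of V "s + 1" t] by (auto simp: vtx_in)
    then show False
      using assms(2) unfolding consec_def by blast
  qed
  ultimately have "t = s + 1"
    by simp
  then show ?thesis
    using that s t by auto
qed

lemma consec_next:
  assumes "finite V" "a \<in> V" "a < Max V"
  obtains b where "consec V a b"
proof -
  let ?S = "{x \<in> V. a < x}"
  have S: "finite ?S" "?S \<noteq> {}"
    using assms Max_in[of V] by (simp, blast)
  have "Min ?S \<in> ?S" "\<And>x. x \<in> ?S \<Longrightarrow> Min ?S \<le> x"
    using S(1) Min_in[OF S] by auto
  then have "consec V a (Min ?S)"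
    using assms(2) unfolding consec_def by fastforce
  then show ?thesis
    using that by blast
qed

lemma consec_around:
  assumes "finite V" "p \<in> V" "q \<in> V" "p < x" "x < q" "x \<notin> V"
  obtains a b where "consec V a b" "a < x" "x < b" "p \<le> a" "b \<le> q"
proof -
  let ?A = "{y \<in> V. y < x}" and ?B = "{y \<in> V. x < y}"
  have fin: "finite ?A" "?A \<noteq> {}" "finite ?B" "?B \<noteq> {}"
    using assms by auto
  have m: "Max ?A \<in> ?A" "Min ?B \<in> ?B" "\<And>y. y \<in> ?A \<Longrightarrow> y \<le> Max ?A" "\<And>y. y \<in> ?B \<Longrightarrow> Min ?B \<le> y"
    using fin(1,3) Max_in[OF fin(1,2)] Min_in[OF fin(3,4)] by auto
  have "consec V (Max ?A) (Min ?B)"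
    unfolding consec_def
  proof (intro conjI ballI notI)
    fix y assume y: "y \<in> V" "Max ?A < y \<and> y < Min ?B"
    with assms(6) have "y \<in> ?A \<or> y \<in> ?B"
      by (metis (mono_tags, lifting) linorder_neqE_nat mem_Collect_eq)
    with y m(3,4) show False
      by (metis leD)
  qed (use m(1,2) in auto)
  moreover have "p \<le> Max ?A" "Min ?B \<le> q"
    using m(3,4) assms by auto
  ultimately show ?thesis
    using that[of "Max ?A" "Min ?B"] m(1,2) by auto
qed

lemma base_side_eq:
  assumes "finite V" "card V \<ge> 3"
  shows "base_side V = {Min V, Max V}"
proof -
  have "V \<noteq> {}" "card V - 1 + 1 = card V"
    using assms by auto
  then show ?thesis
    unfolding base_side_def side_def using vtx_0[OF assms(1)] vtx_last[OF assms(1)] by auto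
qed

lemma Min_less_Max:
  fixes V :: "nat set"
  assumes "finite V" "card V \<ge> 3"
  shows "Min V < Max V"
proof -
  have "V \<noteq> {}" "0 < card V - 1" "card V - 1 < card V"
    using assms by auto
  then show ?thesis
    using vtx_0[OF assms(1)] vtx_last[OF assms(1)] vtx_less[OF assms(1)] by metis
qed

lemma sides_iff:
  assumes "finite V" "card V \<ge> 3"
  shows "d \<in> sides V \<longleftrightarrow> (\<exists>a b. d = {a, b} \<and> (consec V a b \<or> a = Min V \<and> b = Max V))"
proof
  assume "d \<in> sides V"
  then obtain s where s: "d = side V s" "s < card V"
    unfolding sides_def by blast
  show "\<exists>a b. d = {a, b} \<and> (consec V a b \<or> a = Min V \<and> b = Max V)"
  proof (cases "s + 1 < card V")
    case True
    then show ?thesis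
      using consec_vtx[OF assms(1) True] s by (auto simp: side_def)
  next
    case False
    with s have "d = base_side V"
      by (metis (no_types, lifting) Suc_eq_plus1 add_diff_cancel_right' base_side_def less_antisym less_eq_Suc_le
          linorder_neqE_nat not_less_eq)
    then show ?thesis
      using base_side_eq[OF assms] by auto
  qed
next
  assume "\<exists>a b. d = {a, b} \<and> (consec V a b \<or> a = Min V \<and> b = Max V)"
  then obtain a b where d: "d = {a, b}" and ab: "consec V a b \<or> a = Min V \<and> b = Max V"
    by blast
  from ab show "d \<in> sides V"
  proof
    assume "consec V a b"
    then obtain s where "s + 1 < card V" "a = vtx V s" "b = vtx V (s + 1)"
      using consec_imp_vtx[OF assms(1)] by metis
    then show ?thesis
      unfolding sides_def side_def using d by fastforce
  next
    assume "a = Min V \<and> b = Max V"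
    then have "d = side V (card V - 1)"
      using base_side_eq[OF assms] d by (simp add: base_side_def)
    then show ?thesis
      unfolding sides_def using assms(2) by (auto intro!: exI[of _ "card V - 1"])
  qed
qed

lemma consec_iff_less:
  assumes "consec V a b" "x \<in> V"
  shows "x \<le> a \<longleftrightarrow> x < b"
  using assms by (auto simp: consec_def not_less[symmetric])

section \<open>Cells of a dissection\<close>

lemma polygon_edges_iff:
  assumes "a < b"
  shows "{a, b} \<in> polygon_edges n \<longleftrightarrow> b \<le> n + 1 \<and> (b = a + 1 \<or> a = 0 \<and> b = n + 1)"
proof
  assume "{a, b} \<in> polygon_edges n"
  then obtain i where i: "i < n + 2" "{a, b} = {i, (i + 1) mod (n + 2)}"
    unfolding polygon_edges_def by blast
  show "b \<le> n + 1 \<and> (b = a + 1 \<or> a = 0 \<and> b = n + 1)"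
  proof (cases "i = n + 1")
    case True
    then have "{a, b} = {n + 1, 0}"
      using i by simp
    then show ?thesis
      using assms by (auto simp: doubleton_eq_iff)
  next
    case False
    then have "{a, b} = {i, i + 1}"
      using i by simp
    then show ?thesis
      using assms False i by (auto simp: doubleton_eq_iff)
  qed
next
  assume *: "b \<le> n + 1 \<and> (b = a + 1 \<or> a = 0 \<and> b = n + 1)"
  then have "{a, b} = {a, (a + 1) mod (n + 2)} \<or> {a, b} = {b, (b + 1) mod (n + 2)} \<and> b = n + 1"
    by auto
  then show "{a, b} \<in> polygon_edges n"
    unfolding polygon_edges_def using * assms by fastforce
qed

text \<open>The base edge is included, so that it can serve as a base side on the same footing as a
  chord.\<close>

definition linked :: "nat \<Rightarrow> nat set set \<Rightarrow> nat \<Rightarrow> nat \<Rightarrow> bool" where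
  "linked n D a b \<longleftrightarrow> a < b \<and> b \<le> n + 1 \<and> ({a, b} \<in> D \<or> b = a + 1 \<or> a = 0 \<and> b = n + 1)"

text \<open>The vertices seen from the side \<open>{i, j}\<close> when looking into
  \<open>{i..j}\<close>: those that no chord inside cuts off. The pair \<open>(i, j)\<close> itself
  is exempted, since it would cut off everything strictly between.\<close>

definition cell_below :: "nat set set \<Rightarrow> nat \<Rightarrow> nat \<Rightarrow> nat set" where
  "cell_below D i j = {x. i \<le> x \<and> x \<le> j \<and>
     \<not> (\<exists>a b. i \<le> a \<and> a < x \<and> x < b \<and> b \<le> j \<and> {a, b} \<in> D \<and> (a, b) \<noteq> (i, j))}"

locale dissection =
  fixes n :: nat and D :: "nat set set"
  assumes n_pos: "n \<ge> 1" and dissection: "D \<in> dissections n"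
begin

abbreviation E :: "nat \<Rightarrow> nat \<Rightarrow> bool" where "E \<equiv> linked n D"

lemma chordD:
  assumes "{a, b} \<in> D" "a < b"
  shows "a + 1 < b" "b \<le> n + 1" "(a, b) \<noteq> (0, n + 1)" "E a b"
proof -
  have "{a, b} \<in> diagonals n"
    using assms dissection by (auto simp: dissections_def)
  then have *: "{a, b} \<notin> polygon_edges n" "b < n + 2"
    using assms by (auto simp: diagonals_def doubleton_eq_iff)
  then show "a + 1 < b" "b \<le> n + 1" "(a, b) \<noteq> (0, n + 1)" "E a b"
    using polygon_edges_iff[OF assms(2), of n] assms by (auto simp: linked_def)
qed

lemma chord_cases:
  assumes "d \<in> D"
  obtains a b where "d = {a, b}" "a < b"
proof -
  have "d \<in> diagonals n"
    using assms dissection by (auto simp: dissections_def)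
  then obtain i j where "d = {i, j}" "i \<noteq> j"
    by (auto simp: diagonals_def)
  then show ?thesis
    using that[of i j] that[of j i] by (metis insert_commute linorder_neqE_nat)
qed

lemma finite_D: "finite D"
proof (rule finite_subset)
  show "D \<subseteq> Pow {0..n + 1}"
  proof
    fix d assume d: "d \<in> D"
    then obtain a b where "d = {a, b}" "a < b"
      using chord_cases by blast
    then show "d \<in> Pow {0..n + 1}"
      using chordD(2)[of a b] d by auto
  qed
qed simp

lemma finite_neighbours: "finite {x. {i, x} \<in> D}"
proof (rule finite_subset)
  show "{x. {i, x} \<in> D} \<subseteq> \<Union>D"
    by auto
  show "finite (\<Union>D)"
    using finite_D by (metis chord_cases finite.emptyI finite.insertI finite_Union)
qed

lemma chord_not_crossing:
  assumes "{a, b} \<in> D" "{c, d} \<in> D" "a < c" "c < b"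
  shows "d \<le> b"
proof (rule ccontr)
  assume "\<not> d \<le> b"
  then have "crossing {a, b} {c, d}"
    using assms unfolding crossing_def by (metis not_le)
  then show False
    using assms dissection by (auto simp: dissections_def)
qed

lemma linked_not_crossing:
  assumes "E a b" "E c d" "a < c" "c < b"
  shows "d \<le> b"
  using assms chord_not_crossing[of a b c d] by (auto simp: linked_def)

text \<open>Translates the unordered sides of the definition into ordered pairs, so that
  non-crossing can be applied as an inequality.\<close>

lemma cell_iff:
  "V \<in> cells n D \<longleftrightarrow> V \<subseteq> {0..n + 1} \<and> card V \<ge> 3 \<and> (\<forall>a b. consec V a b \<longrightarrow> E a b) \<and>
     E (Min V) (Max V) \<and>
     (\<forall>a\<in>V. \<forall>b\<in>V. a < b \<and> {a, b} \<in> D \<longrightarrow> consec V a b \<or> a = Min V \<and> b = Max V)"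
  (is "_ \<longleftrightarrow> _ \<and> _ \<and> ?A \<and> ?B \<and> ?C")
proof (cases "V \<subseteq> {0..n + 1} \<and> card V \<ge> 3")
  case True
  then have V: "finite V" "card V \<ge> 3" and sub: "\<And>x. x \<in> V \<Longrightarrow> x \<le> n + 1"
    using finite_subset by auto
  note mm = Min_less_Max[OF V]
  have Max: "Max V \<in> V" "Min V \<in> V"
    using V by (metis Max_in Min_in card.empty not_numeral_le_zero)+
  have E: "{a, b} \<in> polygon_edges n \<union> D \<longleftrightarrow> E a b" if "a < b" "b \<in> V" for a b
    using polygon_edges_iff[OF that(1)] sub[OF that(2)] that by (auto simp: linked_def)
  have "sides V \<subseteq> polygon_edges n \<union> D \<longleftrightarrow> ?A \<and> ?B"
  proof
    assume *: "sides V \<subseteq> polygon_edges n \<union> D"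
    show "?A \<and> ?B"
    proof (intro conjI allI impI)
      fix a b assume ab: "consec V a b"
      then have "{a, b} \<in> polygon_edges n \<union> D"
        using * sides_iff[OF V] by blast
      then show "E a b"
        using ab E unfolding consec_def by blast
    next
      have "{Min V, Max V} \<in> polygon_edges n \<union> D"
        using * sides_iff[OF V] by blast
      then show ?B
        using mm E Max by blast
    qed
  next
    assume *: "?A \<and> ?B"
    show "sides V \<subseteq> polygon_edges n \<union> D"
    proof
      fix d assume "d \<in> sides V"
      then obtain a b where "d = {a, b}" "consec V a b \<or> a = Min V \<and> b = Max V"
        using sides_iff[OF V] by blast
      then show "d \<in> polygon_edges n \<union> D"
        using * E mm Max unfolding consec_def by metis
    qed
  qed
  moreover have "(\<forall>d\<in>D. d \<subseteq> V \<longrightarrow> d \<in> sides V) \<longleftrightarrow> ?C"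
  proof
    assume *: "\<forall>d\<in>D. d \<subseteq> V \<longrightarrow> d \<in> sides V"
    show ?C
    proof (intro ballI impI)
      fix a b assume ab: "a \<in> V" "b \<in> V" "a < b \<and> {a, b} \<in> D"
      then obtain a' b' where "{a, b} = {a', b'}" "consec V a' b' \<or> a' = Min V \<and> b' = Max V"
        using * sides_iff[OF V] by (metis empty_subsetI insert_subset)
      then show "consec V a b \<or> a = Min V \<and> b = Max V"
        using ab mm by (auto simp: doubleton_eq_iff consec_def)
    qed
  next
    assume *: ?C
    show "\<forall>d\<in>D. d \<subseteq> V \<longrightarrow> d \<in> sides V"
    proof (intro ballI impI)
      fix d assume d: "d \<in> D" "d \<subseteq> V"
      then obtain a b where "d = {a, b}" "a < b"
        using chord_cases by blast
      then show "d \<in> sides V"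
        using * d sides_iff[OF V] by (metis insert_subset)
    qed
  qed
  ultimately show ?thesis
    using True by (simp add: cells_def)
qed (auto simp: cells_def)

lemma cellD:
  assumes "V \<in> cells n D"
  shows "finite V" "card V \<ge> 3" "V \<noteq> {}" "\<And>a b. consec V a b \<Longrightarrow> E a b" "E (Min V) (Max V)"
    "\<And>a b. a \<in> V \<Longrightarrow> b \<in> V \<Longrightarrow> a < b \<Longrightarrow> {a, b} \<in> D \<Longrightarrow> consec V a b \<or> a = Min V \<and> b = Max V"
    "Min V \<in> V" "Max V \<in> V" "Min V < Max V" "\<And>x. x \<in> V \<Longrightarrow> Min V \<le> x"
    "\<And>x. x \<in> V \<Longrightarrow> x \<le> Max V"
proof -
  show *: "finite V" "card V \<ge> 3"
    using assms finite_subset[of V "{0..n+1}"] by (auto simp: cell_iff)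
  then show "V \<noteq> {}"
    by auto
  then show "Min V \<in> V" "Max V \<in> V" "Min V < Max V" "\<And>x. x \<in> V \<Longrightarrow> Min V \<le> x"
    "\<And>x. x \<in> V \<Longrightarrow> x \<le> Max V"
    using * Min_less_Max by auto
qed (use assms in \<open>auto simp: cell_iff\<close>)

lemma cell_not_two:
  assumes "V \<in> cells n D"
  shows "\<not> consec V (Min V) (Max V)"
proof
  note V = cellD[OF assms]
  assume "consec V (Min V) (Max V)"
  then have "V \<subseteq> {Min V, Max V}"
    using V(10,11) unfolding consec_def by (metis insertCI le_neq_implies_less subsetI)
  then have "card V \<le> card {Min V, Max V}"
    by (intro card_mono) auto
  then show False
    using V(2,9) by simp
qed

text \<open>The base edge is ruled out: as a consecutive pair it would consist of the least and the
  greatest vertex, leaving only two vertices.\<close>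

lemma consec_chord:
  assumes "V \<in> cells n D" "consec V a b"
  shows "b = a + 1 \<or> {a, b} \<in> D"
proof (rule ccontr)
  note V = cellD[OF assms(1)]
  assume "\<not> ?thesis"
  then have "a = 0" "b = n + 1"
    using V(4)[OF assms(2)] by (auto simp: linked_def)
  moreover have "Max V \<le> n + 1"
    using V(5) by (simp add: linked_def)
  ultimately have "Min V = a" "Max V = b"
    using V(10)[of a] V(11)[of b] assms(2) by (auto simp: consec_def)
  then show False
    using cell_not_two assms by metis
qed

text \<open>An end of the pair strictly inside a gap of \<open>V\<close> would force a crossing with
  the side bounding that gap. So if the pair does not enclose \<open>V\<close>, both ends are
  vertices of \<open>V\<close>; as no chord cuts a cell, the pair is then a side, and the only side
  passing over a vertex is the base side.\<close>

lemma chord_over_cell: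
  assumes "V \<in> cells n D" "E a b" "x \<in> V" "a < x" "x < b"
  shows "a \<le> Min V" "Max V \<le> b"
proof -
  note V = cellD[OF assms(1)]
  have lo: "a \<in> V" if "Min V \<le> a"
  proof (rule ccontr)
    assume "a \<notin> V"
    moreover from this have "Min V < a"
      using that V(7) by (metis le_neq_implies_less)
    ultimately obtain p q where "consec V p q" "p < a" "a < q" "q \<le> x"
      using consec_around[OF V(1,7) assms(3)] assms(4) by metis
    then show False
      using linked_not_crossing[OF V(4) assms(2)] assms(5) by fastforce
  qed
  have hi: "b \<in> V" if "b \<le> Max V"
  proof (rule ccontr)
    assume "b \<notin> V"
    moreover from this have "b < Max V"
      using that V(8) by (metis le_neq_implies_less)
    ultimately obtain p q where "consec V p q" "p < b" "b < q" "x \<le> p"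
      using consec_around[OF V(1) assms(3) V(8) assms(5)] by metis
    then show False
      using linked_not_crossing[OF assms(2) V(4)] assms(4) by fastforce
  qed
  have no: "a = Min V \<and> b = Max V" if "a \<in> V" "b \<in> V"
  proof -
    have "\<not> consec V a b"
      using assms by (auto simp: consec_def)
    then have "a = 0 \<and> b = n + 1 \<or> {a, b} \<in> D"
      using assms by (auto simp: linked_def)
    then show ?thesis
    proof
      assume "a = 0 \<and> b = n + 1"
      moreover have "Max V \<le> n + 1"
        using V(5) by (simp add: linked_def)
      ultimately show ?thesis
        using V(10)[OF that(1)] V(11)[OF that(2)] by auto
    next
      assume "{a, b} \<in> D"
      then show ?thesis
        using V(6) that \<open>\<not> consec V a b\<close> assms by fastforce
    qed
  qed
  have x: "Min V \<le> x" "x \<le> Max V"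
    using V assms by auto
  show "a \<le> Min V"
  proof (rule ccontr)
    assume *: "\<not> a \<le> Min V"
    then have "b \<le> Max V"
      using linked_not_crossing[OF V(5) assms(2)] x assms(4) by simp
    then show False
      using * lo hi no by fastforce
  qed
  show "Max V \<le> b"
  proof (rule ccontr)
    assume *: "\<not> Max V \<le> b"
    then have "\<not> a < Min V"
      using linked_not_crossing[OF assms(2) V(5)] x assms(5) by linarith
    then show False
      using * lo hi no by fastforce
  qed
qed

lemma chord_over_cell':
  assumes "V \<in> cells n D" "{a, b} \<in> D" "x \<in> V" "a < x" "x < b"
  shows "a \<le> Min V" "Max V \<le> b"
  using chord_over_cell[OF assms(1) _ assms(3-)] chordD(4)[of a b] assms by auto

text \<open>The main point is that two consecutive visible vertices \<open>a\<close>,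
  \<open>b\<close> with a gap between them are joined by a chord. Something cuts off
  \<open>a + 1\<close> but not \<open>a\<close>, so it starts at \<open>a\<close>; the longest such
  chord must end at \<open>b\<close>.\<close>

lemma cell_below_cell:
  assumes "E i j" "i + 1 < j"
  shows "cell_below D i j \<in> cells n D" "Min (cell_below D i j) = i" "Max (cell_below D i j) = j"
proof -
  let ?V = "cell_below D i j"
  have V: "x \<in> ?V \<longleftrightarrow> i \<le> x \<and> x \<le> j \<and>
     \<not> (\<exists>a b. i \<le> a \<and> a < x \<and> x < b \<and> b \<le> j \<and> {a, b} \<in> D \<and> (a, b) \<noteq> (i, j))" for x
    by (auto simp: cell_below_def)
  have ij: "i \<in> ?V" "j \<in> ?V"
    using assms by (auto simp: V)
  have sub: "?V \<subseteq> {i..j}"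
    by (auto simp: V)
  then have fin: "finite ?V"
    using finite_subset by blast
  show MM: "Min ?V = i" "Max ?V = j"
    using fin ij sub by (auto intro!: Min_eqI Max_eqI)
  have cons: "b = a + 1 \<or> {a, b} \<in> D \<and> (a, b) \<noteq> (i, j)" if ab: "consec ?V a b" for a b
  proof (cases "b = a + 1")
    case False
    have ab': "a \<in> ?V" "b \<in> ?V" "a < b" "a + 1 \<notin> ?V"
      using ab False unfolding consec_def by (auto dest: bspec[of _ _ "a + 1"])
    then have i1: "i \<le> a + 1" "a + 1 \<le> j"
      by (auto simp: V)
    let ?P = "\<lambda>q. a + 1 < q \<and> q \<le> j \<and> {a, q} \<in> D \<and> (a, q) \<noteq> (i, j)"
    obtain p q where pq: "i \<le> p" "p < a + 1" "a + 1 < q" "q \<le> j" "{p, q} \<in> D" "(p, q) \<noteq> (i, j)"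
      using ab'(4) i1 V[of "a + 1"] by blast
    then have "p = a"
      using ab'(1) V[of a] by (metis Suc_eq_plus1 Suc_lessD less_Suc_eq)
    with pq have ex: "?P q"
      by simp
    have bd: "y \<le> j" if "?P y" for y
      using that by simp
    \<comment> \<open>The far end of the longest chord from \<open>a\<close>. If \<open>m\<close>
      were cut off, the chord responsible would also cut off \<open>a\<close>, be a longer chord
      from \<open>a\<close>, or cross \<open>{a, m}\<close>.\<close>
    define m where "m = (GREATEST q. ?P q)"
    have m: "?P m"
      unfolding m_def by (rule GreatestI_nat[of ?P, OF ex bd])
    have mle: "y \<le> m" if "?P y" for y
      unfolding m_def by (rule Greatest_le_nat[of ?P, OF that bd])
    have "m \<le> b"
    proof (rule ccontr)
      assume "\<not> m \<le> b"
      then show False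
        using ab' m V[of a] V[of b] by (metis not_le)
    qed
    moreover have "b \<le> m"
    proof (rule ccontr)
      assume "\<not> b \<le> m"
      then have "m \<notin> ?V" "i \<le> m" "m \<le> j"
        using ab m ab' V[of a] unfolding consec_def by auto
      then obtain c d where cd: "i \<le> c" "c < m" "m < d" "d \<le> j" "{c, d} \<in> D" "(c, d) \<noteq> (i, j)"
        using V by blast
      consider "c < a" | "c = a" | "a < c"
        by linarith
      then show False
      proof cases
        case 1
        moreover have "a < d"
          using cd m by linarith
        ultimately show ?thesis
          using cd ab'(1) V[of a] by blast
      next
        case 2
        then have "?P d"
          using cd m by auto
        then show ?thesis
          using mle[of d] cd by simp
      next
        case 3
        then show ?thesis
          using chord_not_crossing[of a m c d] m cd by simp
      qed
    qed
    ultimately show ?thesis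
      using m by auto
  qed simp
  \<comment> \<open>A third vertex exists, since otherwise \<open>i\<close> and \<open>j\<close>
    would be consecutive, and \<open>cons\<close> excludes the pair \<open>(i, j)\<close>.\<close>
  have "\<not> consec ?V i j"
    using cons assms by fastforce
  then obtain x where "x \<in> ?V" "i < x" "x < j"
    using ij assms unfolding consec_def by auto
  then have "{i, x, j} \<subseteq> ?V" "card {i, x, j} = 3"
    using ij by auto
  then have "card ?V \<ge> 3"
    using card_mono[OF fin] by metis
  moreover have "E a b" if "consec ?V a b" for a b
    using cons[OF that] chordD(4) that assms sub unfolding consec_def linked_def by fastforce
  moreover have "consec ?V a b \<or> a = i \<and> b = j"
    if "a \<in> ?V" "b \<in> ?V" "a < b" "{a, b} \<in> D" for a b
    using that V unfolding consec_def by (metis prod.inject)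
  ultimately show "?V \<in> cells n D"
    unfolding cell_iff MM using assms sub by (auto simp: linked_def)
qed

text \<open>A point outside \<open>V\<close> lies in a gap, and the side bounding the gap is a chord
  that cuts it off. Together with \<open>cell_below_cell\<close>, cells correspond to linked pairs
  with \<open>i + 1 < j\<close>.\<close>

lemma cell_eq_cell_below:
  assumes "V \<in> cells n D"
  shows "V = cell_below D (Min V) (Max V)"
proof (intro set_eqI iffI)
  note V = cellD[OF assms]
  fix x
  show "x \<in> cell_below D (Min V) (Max V)" if x: "x \<in> V"
    unfolding cell_below_def
  proof (intro CollectI conjI notI)
    assume "\<exists>a b. Min V \<le> a \<and> a < x \<and> x < b \<and> b \<le> Max V \<and> {a, b} \<in> D \<and> (a, b) \<noteq> (Min V, Max V)"
    then show False
      using chord_over_cell'[OF assms _ x] by (metis le_antisym)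
  qed (use V x in auto)
  show "x \<in> V" if x: "x \<in> cell_below D (Min V) (Max V)"
  proof (rule ccontr)
    assume nx: "x \<notin> V"
    then have "Min V < x" "x < Max V"
      using x V(7,8) unfolding cell_below_def by (auto simp: order_less_le)
    then obtain a b where ab: "consec V a b" "a < x" "x < b" "Min V \<le> a" "b \<le> Max V"
      using consec_around[OF V(1,7,8) _ _ nx] by metis
    then have "{a, b} \<in> D" "(a, b) \<noteq> (Min V, Max V)"
      using consec_chord[OF assms ab(1)] cell_not_two[OF assms] by auto
    then show False
      using x ab unfolding cell_below_def by blast
  qed
qed

text \<open>Take the shortest linked pair \<open>(p, q)\<close> properly enclosing
  \<open>(i, j)\<close>; the base edge is a candidate. A chord hiding \<open>i\<close> or
  \<open>j\<close> from it would, by non-crossing, enclose \<open>(i, j)\<close> and be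
  shorter.\<close>

lemma cell_above_exists:
  assumes "E i j" "(i, j) \<noteq> (0, n + 1)"
  obtains V where "V \<in> cells n D" "consec V i j"
proof -
  let ?P = "\<lambda>(p, q). p \<le> i \<and> j \<le> q \<and> (p, q) \<noteq> (i, j) \<and> E p q"
  have "?P (0, n + 1)"
    using assms by (auto simp: linked_def)
  then obtain pq where "?P pq" and least: "\<And>y. ?P y \<Longrightarrow> snd pq - fst pq \<le> snd y - fst y"
    using ex_has_least_nat[of ?P "(0, n + 1)" "\<lambda>z. snd z - fst z"] by blast
  then obtain p q where pq: "p \<le> i" "j \<le> q" "(p, q) \<noteq> (i, j)" "E p q" and eq: "pq = (p, q)"
    by (cases pq) auto
  have ij: "i < j"
    using assms by (simp add: linked_def)
  then have "p + 1 < q"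
    using pq by auto
  note V = cell_below_cell[OF pq(4) this]
  have min: "q - p \<le> b - a" if "{a, b} \<in> D" "a \<le> i" "j \<le> b" "(a, b) \<noteq> (i, j)" for a b
    using least[of "(a, b)"] that ij chordD(4)[of a b] eq by fastforce
  have "i \<in> cell_below D p q"
    unfolding cell_below_def
  proof (intro CollectI conjI notI)
    assume "\<exists>a b. p \<le> a \<and> a < i \<and> i < b \<and> b \<le> q \<and> {a, b} \<in> D \<and> (a, b) \<noteq> (p, q)"
    then obtain a b where ab: "p \<le> a" "a < i" "i < b" "b \<le> q" "{a, b} \<in> D" "(a, b) \<noteq> (p, q)"
      by blast
    have "j \<le> b"
      using linked_not_crossing[OF chordD(4)[OF ab(5)] assms(1)] ab by simp
    then show False
      using min[OF ab(5)] ab by auto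
  qed (use pq ij in auto)
  moreover have "j \<in> cell_below D p q"
    unfolding cell_below_def
  proof (intro CollectI conjI notI)
    assume "\<exists>a b. p \<le> a \<and> a < j \<and> j < b \<and> b \<le> q \<and> {a, b} \<in> D \<and> (a, b) \<noteq> (p, q)"
    then obtain a b where ab: "p \<le> a" "a < j" "j < b" "b \<le> q" "{a, b} \<in> D" "(a, b) \<noteq> (p, q)"
      by blast
    have "a \<le> i"
      using linked_not_crossing[OF assms(1) chordD(4)[OF ab(5)]] ab by fastforce
    then show False
      using min[OF ab(5)] ab by auto
  qed (use pq ij in auto)
  moreover have "\<not> (i < x \<and> x < j)" if "x \<in> cell_below D p q" for x
  proof
    assume "i < x \<and> x < j"
    moreover from this have "{i, j} \<in> D"
      using assms by (auto simp: linked_def)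
    ultimately show False
      using that pq unfolding cell_below_def by blast
  qed
  ultimately have "consec (cell_below D p q) i j"
    using ij by (auto simp: consec_def)
  then show ?thesis
    using that V(1) by blast
qed

text \<open>The base side of each cell passes strictly over \<open>i\<close> or \<open>j\<close>, a
  vertex of the other cell, hence over that whole cell. By symmetry the base sides coincide, and
  they determine the cells.\<close>

lemma cell_above_unique:
  assumes "V \<in> cells n D" "W \<in> cells n D" "consec V i j" "consec W i j"
  shows "V = W"
proof -
  have *: "Min W \<le> Min V \<and> Max V \<le> Max W"
    if "V \<in> cells n D" "W \<in> cells n D" "consec V i j" "consec W i j" for V W
  proof -
    note W = cellD[OF that(2)]
    have mem: "i \<in> V" "j \<in> V" "i < j" "Min W \<le> i" "j \<le> Max W"
      using that W by (auto simp: consec_def)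
    moreover have "(Min W, Max W) \<noteq> (i, j)"
      using cell_not_two that by blast
    ultimately have "Min W < i \<and> i < Max W \<or> Min W < j \<and> j < Max W"
      by auto
    then show ?thesis
      using chord_over_cell[OF that(1) W(5)] mem by blast
  qed
  have "Min V = Min W" "Max V = Max W"
    using *[OF assms] *[OF assms(2,1,4,3)] by auto
  then show ?thesis
    using cell_eq_cell_below assms by metis
qed

end

section \<open>Quiddity and degrees\<close>

definition degree :: "nat set set \<Rightarrow> nat \<Rightarrow> nat" where
  "degree D i = card {d \<in> D. i \<in> d}"

lemma consec_right_unique: "consec V a b \<Longrightarrow> consec V a c \<Longrightarrow> b = c"
  unfolding consec_def by (metis linorder_neqE_nat)

context dissection
begin

lemma degree_eq: "degree D i = card {x. {i, x} \<in> D}"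
proof -
  have "{d \<in> D. i \<in> d} = (\<lambda>x. {i, x}) ` {x. {i, x} \<in> D}"
  proof (intro set_eqI iffI)
    fix d assume d: "d \<in> {d \<in> D. i \<in> d}"
    then obtain a b where "d = {a, b}"
      using chord_cases by blast
    with d show "d \<in> (\<lambda>x. {i, x}) ` {x. {i, x} \<in> D}"
      by (auto simp: insert_commute)
  qed auto
  moreover have "inj_on (\<lambda>x. {i, x}) {x. {i, x} \<in> D}"
    by (auto simp: inj_on_def doubleton_eq_iff)
  ultimately show ?thesis
    by (simp add: degree_def card_image)
qed

lemma neighbour_neq:
  assumes "{i, x} \<in> D"
  shows "x \<noteq> i"
  using assms chord_cases[OF assms]
  by (metis insertI1 insert_absorb2 less_irrefl singletonD insert_commute)

lemma finite_cells: "finite (cells n D)"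
  by (rule finite_subset[of _ "Pow {0..n + 1}"]) (auto simp: cells_def)

text \<open>A cell ending at \<open>i\<close> is determined by its base side, hence by its least
  vertex.\<close>

lemma card_cells_closing:
  "card {V \<in> cells n D. i = Max V} = card {y. y + 1 < i \<and> E y i}"
proof (rule bij_betw_same_card)
  show "bij_betw Min {V \<in> cells n D. i = Max V} {y. y + 1 < i \<and> E y i}"
    unfolding bij_betw_def
  proof
    show "inj_on Min {V \<in> cells n D. i = Max V}"
    proof (rule inj_onI)
      fix V W assume "V \<in> {V \<in> cells n D. i = Max V}" "W \<in> {V \<in> cells n D. i = Max V}" "Min V = Min W"
      then show "V = W"
        using cell_eq_cell_below[of V] cell_eq_cell_below[of W] by auto
    qed
    show "Min ` {V \<in> cells n D. i = Max V} = {y. y + 1 < i \<and> E y i}"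
    proof (intro set_eqI iffI)
      fix y assume "y \<in> Min ` {V \<in> cells n D. i = Max V}"
      then obtain V where V: "V \<in> cells n D" "i = Max V" "y = Min V"
        by blast
      have "i \<noteq> y + 1"
        using V cell_not_two[OF V(1)] cellD(7,8,9)[OF V(1)] unfolding consec_def by auto
      then show "y \<in> {y. y + 1 < i \<and> E y i}"
        using V cellD(5,9)[OF V(1)] by auto
    next
      fix y assume "y \<in> {y. y + 1 < i \<and> E y i}"
      then show "y \<in> Min ` {V \<in> cells n D. i = Max V}"
        using cell_below_cell[of y i] by (intro image_eqI[of _ _ "cell_below D y i"]) auto
    qed
  qed
qed

text \<open>Each such cell is matched with the successor of \<open>i\<close> in it; conversely,
  every linked pair except the base edge has exactly one cell above it.\<close>

lemma card_cells_not_closing: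
  "card {V \<in> cells n D. i \<in> V \<and> i < Max V} = card {x. E i x \<and> (i, x) \<noteq> (0, n + 1)}"
proof (rule bij_betw_same_card)
  let ?B = "{V \<in> cells n D. i \<in> V \<and> i < Max V}"
  define f where "f V = (THE b. consec V i b)" for V
  have f: "f V = b" if "consec V i b" for V b
    unfolding f_def using that consec_right_unique by (intro the_equality) blast+
  have fB: "consec V i (f V)" if "V \<in> ?B" for V
    using that f consec_next[of V i] cellD(1)[of V] by (metis (mono_tags, lifting) mem_Collect_eq)
  show "bij_betw f ?B {x. E i x \<and> (i, x) \<noteq> (0, n + 1)}"
    unfolding bij_betw_def
  proof
    show "inj_on f ?B"
    proof (rule inj_onI)
      fix V W assume VW: "V \<in> ?B" "W \<in> ?B" "f V = f W"
      then have "consec V i (f V)" "consec W i (f V)"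
        using fB by metis+
      then show "V = W"
        using cell_above_unique VW by blast
    qed
    show "f ` ?B = {x. E i x \<and> (i, x) \<noteq> (0, n + 1)}"
    proof (intro set_eqI iffI)
      fix x assume "x \<in> f ` ?B"
      then obtain V where V: "V \<in> ?B" "x = f V"
        by blast
      then have c: "consec V i x"
        using fB by simp
      then have "E i x" "x = i + 1 \<or> {i, x} \<in> D" "i < x"
        using V cellD(4)[of V i x] consec_chord[of V i x] by (simp_all, simp add: consec_def)
      then show "x \<in> {x. E i x \<and> (i, x) \<noteq> (0, n + 1)}"
        using chordD(3)[of i x] n_pos by auto
    next
      fix x assume "x \<in> {x. E i x \<and> (i, x) \<noteq> (0, n + 1)}"
      then obtain V where V: "V \<in> cells n D" "consec V i x"
        using cell_above_exists[of i x] by auto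
      then have "V \<in> ?B"
        using cellD(11)[OF V(1), of x] by (auto simp: consec_def)
      then show "x \<in> f ` ?B"
        using f[OF V(2)] by blast
    qed
  qed
qed

lemma card_cells_at:
  assumes "i \<le> n + 1"
  shows "card {V \<in> cells n D. i \<in> V} = degree D i + 1"
proof -
  let ?A = "{V \<in> cells n D. i = Max V}" and ?B = "{V \<in> cells n D. i \<in> V \<and> i < Max V}"
  let ?C = "{y. y + 1 < i \<and> E y i}" and ?F = "{x. E i x \<and> (i, x) \<noteq> (0, n + 1)}"
  let ?N = "{x. {i, x} \<in> D}"
  \<comment> \<open>The one polygon edge counted besides the chords: \<open>?F\<close> contributes
    the edge to \<open>i + 1\<close>, and at \<open>i = n + 1\<close>, where \<open>?F\<close> is
    empty, \<open>?C\<close> contributes the base edge.\<close>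
  define e where "e = (if i = n + 1 then 0 else i + 1)"
  have eq: "{V \<in> cells n D. i \<in> V} = ?A \<union> ?B"
    using cellD(8,11) by (auto simp: order_less_le)
  have "card {V \<in> cells n D. i \<in> V} = card ?A + card ?B"
    unfolding eq by (rule card_Un_disjoint) (use finite_cells in auto)
  also have "\<dots> = card ?C + card ?F"
    by (simp only: card_cells_closing card_cells_not_closing)
  also have "\<dots> = card (?C \<union> ?F)"
    by (rule card_Un_disjoint[symmetric])
      (auto simp: linked_def intro: finite_subset[of _ "{0..n + 1}"])
  also have "?C \<union> ?F = insert e ?N"
  proof (intro set_eqI)
    fix x
    show "x \<in> ?C \<union> ?F \<longleftrightarrow> x \<in> insert e ?N"
    proof (cases x i rule: linorder_cases)
      case less
      then show ?thesis
        using chordD(1-3)[of x i] assms n_pos by (auto simp: e_def linked_def insert_commute)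
    next
      case equal
      then show ?thesis
        using neighbour_neq[of i i] n_pos by (auto simp: e_def linked_def)
    next
      case greater
      then show ?thesis
        using chordD(1-3)[of i x] assms n_pos by (auto simp: e_def linked_def)
    qed
  qed
  also have "card (insert e ?N) = card ?N + 1"
  proof -
    have "e \<notin> ?N"
      using chordD(1,3)[of i "i + 1"] chordD(3)[of 0 i] by (auto simp: e_def insert_commute)
    then show ?thesis
      using finite_neighbours by simp
  qed
  finally show ?thesis
    by (simp add: degree_eq)
qed

lemma quiddity_eq: "quiddity n D = map (\<lambda>i. degree D i + 1) [0..<n + 2]"
  unfolding quiddity_def by (rule map_cong) (auto simp: card_cells_at)

section \<open>The index of sides\<close>

lemma side_eq_consec:
  assumes "V \<in> cells n D" "s + 1 < card V"
  shows "side V s = {vtx V s, vtx V (s + 1)}" "consec V (vtx V s) (vtx V (s + 1))"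
  using consec_vtx[OF cellD(1)[OF assms(1)] assms(2)] by (auto simp: side_def)

text \<open>Induction outwards: the base side of a non-base cell is a side of the cell above it,
  whose base side is longer. The bound \<open>c < 3\<close> allows an index to be compared with a
  residue later.\<close>

lemma z3_index_exists:
  assumes "V \<in> cells n D"
  shows "\<exists>c<3. z3_index n D (base_side V) c"
  using assms
proof (induction "n + 1 - (Max V - Min V)" arbitrary: V rule: less_induct)
  case less
  note V = cellD[OF less.prems]
  show ?case
  proof (cases "(Min V, Max V) = (0, n + 1)")
    case True
    then have "base_side V = base_edge n"
      using base_side_eq[OF V(1,2)] by (simp add: base_edge_def insert_commute)
    then show ?thesis
      using z3_index.base[of n D] by (intro exI[of _ 0]) simp
  next
    case False
    obtain W where W: "W \<in> cells n D" "consec W (Min V) (Max V)"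
      using cell_above_exists[OF V(5) False] .
    have "(Min W, Max W) \<noteq> (Min V, Max V)"
      using cell_not_two[OF W(1)] W(2) by auto
    moreover have "Min W \<le> Min V" "Max V \<le> Max W" "Max W \<le> n + 1"
      using W cellD(5,10,11)[OF W(1)] by (auto simp: consec_def linked_def)
    ultimately have "n + 1 - (Max W - Min W) < n + 1 - (Max V - Min V)"
      using V(9) by auto
    then obtain c where "z3_index n D (base_side W) c"
      using less.hyps W(1) by blast
    moreover obtain s where "s + 1 < card W" "Min V = vtx W s" "Max V = vtx W (s + 1)"
      using consec_imp_vtx[OF cellD(1)[OF W(1)] W(2)] .
    ultimately have "z3_index n D (base_side V) ((c + s + 1) mod 3)"
      using z3_index.side[OF W(1), of c s] base_side_eq[OF V(1,2)] by (simp add: side_def)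
    then show ?thesis
      by (meson mod_less_divisor zero_less_numeral)
  qed
qed

lemma side_neq_base_edge:
  assumes "V \<in> cells n D" "s + 1 < card V"
  shows "side V s \<noteq> base_edge n"
proof
  assume "side V s = base_edge n"
  moreover note se = side_eq_consec[OF assms]
  ultimately have "vtx V s = 0" "vtx V (s + 1) = n + 1"
    by (auto simp: consec_def base_edge_def doubleton_eq_iff)
  then show False
    using consec_chord[OF assms(1) se(2)] n_pos chordD(3)[of 0 "n + 1"] by auto
qed

text \<open>With \<open>side_neq_base_edge\<close>, this makes the rules of \<open>z3_index\<close>
  deterministic, so that indices are unique.\<close>

lemma side_inject:
  assumes "V \<in> cells n D" "s + 1 < card V" "W \<in> cells n D" "t + 1 < card W" "side V s = side W t"
  shows "V = W \<and> s = t"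
proof -
  note V = side_eq_consec[OF assms(1,2)] and W = side_eq_consec[OF assms(3,4)]
  have v: "vtx V s = vtx W t" "vtx V (s + 1) = vtx W (t + 1)"
    using V W assms(5) by (auto simp: doubleton_eq_iff consec_def)
  then have "V = W"
    using cell_above_unique[OF assms(1,3) V(2)] W(2) by simp
  then show ?thesis
    using v card_below_vtx[OF cellD(1)[OF assms(1)]] assms(2,4) by (metis add_lessD1)
qed

lemma z3_index_unique: "z3_index n D e c \<Longrightarrow> z3_index n D e c' \<Longrightarrow> c = c'"
proof (induction arbitrary: c' rule: z3_index.induct)
  case base
  then show ?case
    by cases (use side_neq_base_edge in metis)+
next
  case (side V c s)
  from side.prems show ?case
  proof cases
    case base
    then show ?thesis
      using side_neq_base_edge side by metis
  next
    case (side W d t)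
    have "V = W" "s = t"
      using side_inject[OF side.hyps(1,3) side(3,5)] side(1) by auto
    then show ?thesis
      using side side.IH by metis
  qed
qed

lemma z3_index_eq_base_iff:
  assumes "V \<in> cells n D" "s + 1 < card V"
  shows "(\<exists>c. z3_index n D (side V s) c \<and> z3_index n D (base_side V) c) \<longleftrightarrow> s mod 3 = 2"
proof
  assume "\<exists>c. z3_index n D (side V s) c \<and> z3_index n D (base_side V) c"
  then obtain c where "z3_index n D (side V s) c" "z3_index n D (base_side V) c"
    by blast
  then have "c = (c + s + 1) mod 3"
    using z3_index.side[OF assms(1) _ assms(2)] z3_index_unique by metis
  then show "s mod 3 = 2"
    by presburger
next
  assume s: "s mod 3 = 2"
  obtain c where c: "c < 3" "z3_index n D (base_side V) c"
    using z3_index_exists[OF assms(1)] by blast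
  then have "(c + s + 1) mod 3 = c"
    using s by presburger
  then show "\<exists>c. z3_index n D (side V s) c \<and> z3_index n D (base_side V) c"
    using c z3_index.side[OF assms(1) c(2) assms(2)] by auto
qed

end

section \<open>Three-periodicity by counting chords\<close>

definition inner :: "nat set set \<Rightarrow> nat \<Rightarrow> nat \<Rightarrow> nat" where
  "inner D i j = card {d \<in> D. d \<subseteq> {i..j}}"

text \<open>Here \<open>l\<close> is the length of the base chord and \<open>c\<close> the number of
  vertices: the \<open>c - 1\<close> other sides contribute 2 each and the base chord 1. The
  equation amounts to \<open>2 * c\<close> being 0 mod 3.\<close>

lemma mod3_cell_iff:
  assumes "c \<ge> (1 :: nat)"
  shows "(l + 2 * (c - 1) + 1) mod 3 = (l + 2) mod 3 \<longleftrightarrow> 3 dvd c"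
proof -
  obtain k where "c = k + 1"
    using assms by (metis add.commute le_Suc_ex plus_1_eq_Suc)
  moreover have "(l + 2 * k + 1) mod 3 = (l + 2) mod 3 \<longleftrightarrow> 3 dvd k + 1"
    by presburger
  ultimately show ?thesis
    by simp
qed

text \<open>Summing the numbers of sides over the cells below a chord \<open>{i, j}\<close> gives
  \<open>j - i + 2 * inner D i j - 1\<close>, as each chord other than \<open>{i, j}\<close> is counted twice. If all these
  cells have size divisible by 3, this yields the congruence.\<close>

definition balanced :: "nat set set \<Rightarrow> nat \<Rightarrow> nat \<Rightarrow> bool" where
  "balanced D i j \<longleftrightarrow> inner D i j mod 3 = (j - i + 2) mod 3"

context dissection
begin

text \<open>A chord inside \<open>{x..y}\<close> lies on one side of \<open>v\<close> or passes over
  it; in the latter case it passes over the whole cell, so it can only be the base side.\<close>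

lemma inner_split:
  assumes "V \<in> cells n D" "v \<in> V" "Min V \<le> x" "x < v" "v < y" "y \<le> Max V"
  shows "inner D x y = inner D x v + inner D v y +
    of_bool ((x, y) = (Min V, Max V) \<and> {x, y} \<in> D)"
proof -
  let ?S = "\<lambda>x y. {d \<in> D. d \<subseteq> {x..y}}"
  let ?T = "{d \<in> D. d = {x, y} \<and> (x, y) = (Min V, Max V)}"
  have T: "card ?T = of_bool ((x, y) = (Min V, Max V) \<and> {x, y} \<in> D)"
  proof (cases "(x, y) = (Min V, Max V) \<and> {x, y} \<in> D")
    case True
    then have "?T = {{x, y}}"
      by auto
    then show ?thesis
      using True by (simp only: card.insert card.empty finite.emptyI of_bool_eq) simp
  next
    case False
    then have "?T = {}"
      by auto
    then show ?thesis
      using False by (simp only: card.empty of_bool_eq)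
  qed
  have "?S x y = (?S x v \<union> ?S v y) \<union> ?T"
  proof (intro set_eqI iffI)
    fix d assume d: "d \<in> ?S x y"
    then obtain a b where ab: "d = {a, b}" "a < b"
      using chord_cases by blast
    show "d \<in> (?S x v \<union> ?S v y) \<union> ?T"
    proof (cases "a < v \<and> v < b")
      case True
      then have "a \<le> Min V" "Max V \<le> b"
        using chord_over_cell'[OF assms(1) _ assms(2)] d ab by auto
      then show ?thesis
        using d ab assms by auto
    next
      case False
      then show ?thesis
        using d ab assms by auto
    qed
  qed (use assms in auto)
  moreover have "card ((?S x v \<union> ?S v y) \<union> ?T) = card (?S x v \<union> ?S v y) + card ?T"
    using finite_D assms by (intro card_Un_disjoint) auto
  moreover have "card (?S x v \<union> ?S v y) = card (?S x v) + card (?S v y)"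
  proof (intro card_Un_disjoint)
    show "?S x v \<inter> ?S v y = {}"
    proof (rule ccontr)
      assume "?S x v \<inter> ?S v y \<noteq> {}"
      then obtain d where d: "d \<in> D" "d \<subseteq> {x..v}" "d \<subseteq> {v..y}"
        by blast
      moreover obtain a b where "d = {a, b}" "a < b"
        using chord_cases d(1) by blast
      ultimately show False
        by auto
    qed
  qed (use finite_D in auto)
  ultimately show ?thesis
    unfolding inner_def T by simp
qed

text \<open>Each side \<open>(a, b)\<close> of the run from \<open>u\<close> to \<open>t\<close>
  contributes \<open>b - a + 2\<close>, and lengths telescope. The full run is excluded because the
  base chord may then lie inside as well. Proper runs are what the two new chords of a surgery
  span.\<close>

lemma inner_partial:
  assumes V: "V \<in> cells n D" and bal: "\<And>a b. consec V a b \<Longrightarrow> balanced D a b"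
    and "u < t" "t < card V" "(u, t) \<noteq> (0, card V - 1)"
  shows "inner D (vtx V u) (vtx V t) mod 3 = (vtx V t - vtx V u + 2 * (t - u)) mod 3"
  using assms(3-)
proof (induction t)
  case (Suc t)
  note fin = cellD(1)[OF V]
  have last: "balanced D (vtx V t) (vtx V (Suc t))"
    using consec_vtx[OF fin, of t] Suc.prems bal by simp
  show ?case
  proof (cases "u = t")
    case True
    then show ?thesis
      using last by (simp add: balanced_def)
  next
    case False
    then have ut: "u < t"
      using Suc.prems by simp
    then have IH: "inner D (vtx V u) (vtx V t) mod 3 = (vtx V t - vtx V u + 2 * (t - u)) mod 3"
      using Suc.prems by (intro Suc.IH) auto
    have lt: "vtx V u < vtx V t" "vtx V t < vtx V (Suc t)"
      using ut Suc.prems vtx_less[OF fin] by auto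
    have mem: "vtx V u \<in> V" "vtx V t \<in> V" "vtx V (Suc t) \<in> V"
      using ut Suc.prems by (auto intro!: vtx_in fin)
    have ne: "(vtx V u, vtx V (Suc t)) \<noteq> (Min V, Max V)"
    proof
      assume eq: "(vtx V u, vtx V (Suc t)) = (Min V, Max V)"
      have "\<not> 0 < u"
        using vtx_less[OF fin, of 0 u] vtx_0[OF fin cellD(3)[OF V]] Suc.prems eq by auto
      moreover have "\<not> Suc t < card V - 1"
        using vtx_less[OF fin, of "Suc t" "card V - 1"] vtx_last[OF fin cellD(3)[OF V]] Suc.prems eq
        by auto
      ultimately show False
        using Suc.prems by auto
    qed
    have "inner D (vtx V u) (vtx V (Suc t)) =
        inner D (vtx V u) (vtx V t) + inner D (vtx V t) (vtx V (Suc t))"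
      using inner_split[OF V mem(2) _ lt] ne cellD(10)[OF V mem(1)] cellD(11)[OF V mem(3)] by auto
    moreover have "inner D (vtx V t) (vtx V (Suc t)) mod 3 = (vtx V (Suc t) - vtx V t + 2) mod 3"
      using last by (simp add: balanced_def)
    ultimately have "inner D (vtx V u) (vtx V (Suc t)) mod 3 =
        ((vtx V t - vtx V u + 2 * (t - u)) + (vtx V (Suc t) - vtx V t + 2)) mod 3"
      using IH by (metis mod_add_eq)
    also have "(vtx V t - vtx V u + 2 * (t - u)) + (vtx V (Suc t) - vtx V t + 2) =
        vtx V (Suc t) - vtx V u + 2 * (Suc t - u)"
      using lt ut by simp
    finally show ?thesis .
  qed
qed simp

lemma inner_full:
  assumes V: "V \<in> cells n D" and bal: "\<And>a b. consec V a b \<Longrightarrow> balanced D a b"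
  shows "inner D (Min V) (Max V) mod 3 =
    (Max V - Min V + 2 * (card V - 1) + of_bool ({Min V, Max V} \<in> D)) mod 3"
proof -
  note C = cellD[OF V]
  \<comment> \<open>Cutting at the last vertex but one leaves two runs that are both proper, the
    second being a single side.\<close>
  define m where "m = card V - 2"
  have m: "0 < m" "m + 1 < card V" "m + 1 = card V - 1" "card V - 1 = Suc m"
    using C(2) by (auto simp: m_def)
  have M: "vtx V 0 = Min V" "vtx V (m + 1) = Max V"
    using vtx_0[OF C(1,3)] vtx_last[OF C(1,3)] m(3) by auto
  have v: "vtx V m \<in> V" "Min V < vtx V m" "vtx V m < Max V"
    using m M vtx_in[OF C(1), of m] vtx_less[OF C(1), of 0 m] vtx_less[OF C(1), of m "m + 1"] by auto
  have "inner D (Min V) (vtx V m) mod 3 = (vtx V m - Min V + 2 * m) mod 3"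
    using inner_partial[OF V bal, of 0 m] m M by auto
  moreover have "inner D (vtx V m) (Max V) mod 3 = (Max V - vtx V m + 2) mod 3"
    using bal[OF consec_vtx[OF C(1) m(2)]] M by (simp add: balanced_def)
  moreover have "inner D (Min V) (Max V) = inner D (Min V) (vtx V m) + inner D (vtx V m) (Max V) +
      of_bool ({Min V, Max V} \<in> D)"
    using inner_split[OF V v(1) _ v(2,3)] by simp
  ultimately have "inner D (Min V) (Max V) mod 3 = ((vtx V m - Min V + 2 * m) +
      (Max V - vtx V m + 2) + of_bool ({Min V, Max V} \<in> D)) mod 3"
    by (metis (no_types, lifting) mod_add_cong mod_mod_trivial)
  moreover have "(vtx V m - Min V + 2 * m) + (Max V - vtx V m + 2) =
      Max V - Min V + 2 * (card V - 1)"
    using v m by simp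
  ultimately show ?thesis
    by simp
qed

lemma inner_edge: "inner D i (i + 1) = 0"
proof -
  have "{d \<in> D. d \<subseteq> {i..i + 1}} = {}"
  proof (rule ccontr)
    assume "{d \<in> D. d \<subseteq> {i..i + 1}} \<noteq> {}"
    then obtain d where d: "d \<in> D" "d \<subseteq> {i..i + 1}"
      by blast
    moreover obtain a b where "d = {a, b}" "a < b"
      using chord_cases d(1) by blast
    ultimately show False
      using chordD(1)[of a b] by auto
  qed
  then show ?thesis
    by (simp only: inner_def card.empty)
qed

lemma inner_all: "inner D 0 (n + 1) = card D"
proof -
  have "{d \<in> D. d \<subseteq> {0..n + 1}} = D"
  proof (intro set_eqI iffI)
    fix d assume d: "d \<in> D"
    then obtain a b where "d = {a, b}" "a < b"
      using chord_cases by blast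
    then show "d \<in> {d \<in> D. d \<subseteq> {0..n + 1}}"
      using chordD(2)[of a b] d by auto
  qed auto
  then show ?thesis
    by (simp only: inner_def)
qed

text \<open>Polygon edges fit in too: they contain no chords, and their length gives
  \<open>1 + 2\<close>, which is 0 mod 3.\<close>

lemma balanced_consec:
  assumes "V \<in> cells n D" "\<And>i j. i < j \<Longrightarrow> {i, j} \<in> D \<Longrightarrow> balanced D i j" "consec V a b"
  shows "balanced D a b"
  using consec_chord[OF assms(1,3)]
proof
  assume "b = a + 1"
  then show ?thesis
    using inner_edge[of a] by (simp add: balanced_def)
next
  assume "{a, b} \<in> D"
  then show ?thesis
    using assms by (simp add: consec_def)
qed

text \<open>Induction on length: the other sides of the cell below the chord are shorter, hence
  balanced, and adding them up leaves the divisibility of the size of that one cell.\<close>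

lemma balanced_chord:
  assumes "\<forall>V\<in>cells n D. 3 dvd card V" "i < j" "{i, j} \<in> D"
  shows "balanced D i j"
  using assms(2,3)
proof (induction "j - i" arbitrary: i j rule: less_induct)
  case less
  note ij = chordD[OF less.prems(2,1)]
  let ?V = "cell_below D i j"
  note V = cell_below_cell[OF ij(4,1)]
  note C = cellD[OF V(1)]
  have bal: "balanced D a b" if ab: "consec ?V a b" for a b
    using consec_chord[OF V(1) ab]
  proof
    assume "b = a + 1"
    then show ?thesis
      using inner_edge[of a] by (simp add: balanced_def)
  next
    assume "{a, b} \<in> D"
    moreover have "i \<le> a" "b \<le> j" "a < b" "(a, b) \<noteq> (i, j)"
      using ab C(10)[of a] C(11)[of b] V(2,3) cell_not_two[OF V(1)] by (auto simp: consec_def)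
    ultimately show ?thesis
      using less.hyps[of b a] by auto
  qed
  have c: "3 dvd card ?V" "card ?V \<ge> 1"
    using assms(1) V(1) C(2) by auto
  have "inner D i j mod 3 = (j - i + 2 * (card ?V - 1) + 1) mod 3"
    using inner_full[OF V(1) bal] less.prems V(2,3) by simp
  also have "\<dots> = (j - i + 2) mod 3"
    using mod3_cell_iff[OF c(2)] c(1) by blast
  finally show ?case
    by (simp add: balanced_def)
qed

text \<open>The last congruence is the condition for the base edge: it is not in \<open>D\<close>,
  so the count is one less than for a chord of length \<open>n + 1\<close>. In the converse, each
  cell is obtained by comparing its base side with the sum over its other sides.\<close>

lemma three_periodic_iff:
  "(\<forall>V\<in>cells n D. 3 dvd card V) \<longleftrightarrow>
     (\<forall>i j. i < j \<and> {i, j} \<in> D \<longrightarrow> balanced D i j) \<and> card D mod 3 = (n + 2) mod 3"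
proof
  assume *: "\<forall>V\<in>cells n D. 3 dvd card V"
  then have bal: "\<And>i j. i < j \<Longrightarrow> {i, j} \<in> D \<Longrightarrow> balanced D i j"
    using balanced_chord by blast
  let ?V = "cell_below D 0 (n + 1)"
  have "E 0 (n + 1)"
    by (simp add: linked_def)
  then have V: "?V \<in> cells n D" "Min ?V = 0" "Max ?V = n + 1"
    using cell_below_cell[of 0 "n + 1"] n_pos by auto
  have nb: "{0, n + 1} \<notin> D"
    using chordD(3)[of 0 "n + 1"] by auto
  have c: "3 dvd card ?V" "card ?V \<ge> 1"
    using * V(1) cellD(2)[OF V(1)] by auto
  have "inner D 0 (n + 1) mod 3 = (n + 1 - 0 + 2 * (card ?V - 1) + of_bool ({0, n + 1} \<in> D)) mod 3"
    using inner_full[OF V(1) balanced_consec[OF V(1) bal]] unfolding V(2,3) .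
  also have "\<dots> = (n + 2) mod 3"
    using nb mod3_cell_iff[OF c(2), of n] c(1) by (simp add: ac_simps)
  finally show "(\<forall>i j. i < j \<and> {i, j} \<in> D \<longrightarrow> balanced D i j) \<and> card D mod 3 = (n + 2) mod 3"
    using bal inner_all by auto
next
  assume *: "(\<forall>i j. i < j \<and> {i, j} \<in> D \<longrightarrow> balanced D i j) \<and> card D mod 3 = (n + 2) mod 3"
  show "\<forall>V\<in>cells n D. 3 dvd card V"
  proof
    fix V assume V: "V \<in> cells n D"
    note C = cellD[OF V]
    have full: "inner D (Min V) (Max V) mod 3 =
        (Max V - Min V + 2 * (card V - 1) + of_bool ({Min V, Max V} \<in> D)) mod 3"
      using inner_full[OF V balanced_consec[OF V]] * by blast
    have c: "card V \<ge> 1"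
      using C(2) by simp
    show "3 dvd card V"
    proof (cases "{Min V, Max V} \<in> D")
      case True
      then have "(Max V - Min V + 2 * (card V - 1) + 1) mod 3 = (Max V - Min V + 2) mod 3"
        using full * C(9) by (auto simp: balanced_def)
      then show ?thesis
        using mod3_cell_iff[OF c] by blast
    next
      case False
      have "Max V \<noteq> Min V + 1"
        using cell_not_two[OF V] C(7,8,9) unfolding consec_def by auto
      then have M: "Min V = 0" "Max V = n + 1"
        using C(5) False by (auto simp: linked_def)
      then have "(n + 2 * (card V - 1) + 1) mod 3 = (n + 2) mod 3"
        using full * False inner_all by (simp add: ac_simps)
      then show ?thesis
        using mod3_cell_iff[OF c] by blast
    qed
  qed
qed

end

section \<open>Existence\<close>

definition total_length :: "nat set set \<Rightarrow> nat" where
  "total_length D = (\<Sum>d\<in>D. Max d - Min d)"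

text \<open>An arbitrary \<open>P\<close> lets one computation serve for degrees, for
  \<open>inner\<close> and for the total number of chords.\<close>

lemma card_filter_insert2:
  assumes "finite F" "x \<notin> F" "y \<notin> F" "x \<noteq> y"
  shows "card {d \<in> F \<union> {x, y}. P d} = card {d \<in> F. P d} + of_bool (P x) + of_bool (P y)"
proof -
  have "{d \<in> F \<union> {x, y}. P d} = {d \<in> F. P d} \<union> ({d. d = x \<and> P x} \<union> {d. d = y \<and> P y})"
    by auto
  also have "card \<dots> = card {d \<in> F. P d} + card ({d. d = x \<and> P x} \<union> {d. d = y \<and> P y})"
    using assms by (intro card_Un_disjoint) auto
  also have "card ({d. d = x \<and> P x} \<union> {d. d = y \<and> P y}) = of_bool (P x) + of_bool (P y)"
    using assms by (cases "P x"; cases "P y") auto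
  finally show ?thesis
    by simp
qed

lemma crossing_sym: "crossing d e \<longleftrightarrow> crossing e d"
  unfolding crossing_def by blast

lemma not_crossing_self: "\<not> crossing d d"
  unfolding crossing_def by (auto simp: doubleton_eq_iff)

lemma not_crossing_disjoint:
  assumes "p < a" "a < b" "b < q"
  shows "\<not> crossing {p, a} {b, q}"
proof
  assume "crossing {p, a} {b, q}"
  then obtain i j k l where "i < j" "j < k" "k < l"
    "{p, a} = {i, k} \<and> {b, q} = {j, l} \<or> {p, a} = {j, l} \<and> {b, q} = {i, k}"
    unfolding crossing_def by blast
  then have "j \<in> {b, q} \<and> k \<in> {p, a} \<or> i \<in> {b, q} \<and> l \<in> {p, a}" "i < l" "j < k"
    by auto
  then show False
    using assms by auto
qed

context dissection
begin

text \<open>A chord crossing \<open>{u, v}\<close> would pass over one of these vertices without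
  enclosing the other, against \<open>chord_over_cell'\<close>.\<close>

lemma not_crossing_cell:
  assumes "V \<in> cells n D" "d \<in> D" "u \<in> V" "v \<in> V"
  shows "\<not> crossing d {u, v}"
proof
  assume "crossing d {u, v}"
  then obtain i j k l where ijkl: "i < j" "j < k" "k < l"
    "d = {i, k} \<and> {u, v} = {j, l} \<or> d = {j, l} \<and> {u, v} = {i, k}"
    unfolding crossing_def by blast
  from ijkl(4) show False
  proof
    assume *: "d = {i, k} \<and> {u, v} = {j, l}"
    then have "j \<in> V" "l \<in> V"
      using assms by (auto simp: doubleton_eq_iff)
    then show False
      using chord_over_cell'(2)[OF assms(1), of i k j] cellD(11)[OF assms(1), of l] * assms(2) ijkl
      by auto
  next
    assume *: "d = {j, l} \<and> {u, v} = {i, k}"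
    then have "i \<in> V" "k \<in> V"
      using assms by (auto simp: doubleton_eq_iff)
    then show False
      using chord_over_cell'(1)[OF assms(1), of j l k] cellD(10)[OF assms(1), of i] * assms(2) ijkl
      by auto
  qed
qed

lemma surgery:
  assumes periodic: "\<forall>V\<in>cells n D. 3 dvd card V"
    and V: "V \<in> cells n D" and s: "s + 1 < card V" "s mod 3 = 2"
    and chords: "{vtx V s, vtx V (s + 1)} \<in> D" "{Min V, Max V} \<in> D"
    and D': "D' = (D - {{vtx V s, vtx V (s + 1)}, {Min V, Max V}}) \<union>
      {{Min V, vtx V s}, {vtx V (s + 1), Max V}}"
  shows "D' \<in> three_periodic_dissections n" "degree D' i = degree D i"
    "total_length D' < total_length D"
proof -
  note C = cellD[OF V]
  define a b p q where "a = vtx V s" and "b = vtx V (s + 1)" and "p = Min V" and "q = Max V"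
  define F where "F = D - {{a, b}, {p, q}}"
  have card3: "3 dvd card V"
    using periodic V by blast
  \<comment> \<open>\<open>s + 1\<close> and \<open>card V\<close> are multiples of 3 with
    \<open>s + 1 < card V\<close>, so they differ by at least 3.\<close>
  then have s2: "2 \<le> s" "s + 4 \<le> card V"
    using s by presburger+
  have s3: "3 dvd s + 1"
    using s(2) by presburger
  have ends: "vtx V 0 = p" "vtx V (card V - 1) = q"
    using vtx_0[OF C(1,3)] vtx_last[OF C(1,3)] by (auto simp: p_def q_def)
  \<comment> \<open>Vertices strictly between \<open>p\<close> and \<open>a\<close> and between
    \<open>b\<close> and \<open>q\<close>. They show that the new pairs are neither polygon edges
    nor already in \<open>D\<close>.\<close>
  define x y where "x = vtx V 1" and "y = vtx V (s + 2)"
  have "s + 2 < card V - 1" "card V - 1 < card V"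
    using s2 by auto
  then have "y < q"
    using vtx_less[OF C(1), of "s + 2" "card V - 1"] unfolding ends y_def by blast
  then have x: "x \<in> V" "p < x" "x < a" and y: "y \<in> V" "b < y" "y < q"
    using s2 vtx_in[OF C(1)] vtx_less[OF C(1), of 0 1] vtx_less[OF C(1), of 1 s]
      vtx_less[OF C(1), of "s + 1" "s + 2"]
    by (auto simp: x_def y_def a_def b_def ends)
  have con: "consec V a b"
    using consec_vtx[OF C(1) s(1)] by (simp add: a_def b_def)
  have mem: "a \<in> V" "b \<in> V" "p \<in> V" "q \<in> V" "a < b"
    using con C(7,8) by (auto simp: consec_def p_def q_def)
  have qn: "q \<le> n + 1"
    using C(5) by (simp add: linked_def q_def)
  have ord: "p + 1 < a" "a < b" "b + 1 < q"
    using x y mem by auto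
  have new: "{p, a} \<notin> D" "{b, q} \<notin> D"
    using C(6)[of p a] C(6)[of b q] mem ord x y unfolding consec_def by (auto simp: p_def q_def)
  have FD: "D = F \<union> {{a, b}, {p, q}}" and FD': "D' = F \<union> {{p, a}, {b, q}}"
    using chords D' by (auto simp: F_def a_def b_def p_def q_def)
  have F: "finite F" "{a, b} \<notin> F" "{p, q} \<notin> F" "{p, a} \<notin> F" "{b, q} \<notin> F" "F \<subseteq> D"
    using finite_D new by (auto simp: F_def)
  have ne: "{a, b} \<noteq> {p, q}" "{p, a} \<noteq> {b, q}"
    using ord by (auto simp: doubleton_eq_iff)
  have cD: "card {d \<in> D. P d} = card {d \<in> F. P d} + of_bool (P {a, b}) + of_bool (P {p, q})" for P
    unfolding FD by (rule card_filter_insert2) (use F ne in auto)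
  have cD': "card {d \<in> D'. P d} = card {d \<in> F. P d} + of_bool (P {p, a}) + of_bool (P {b, q})" for P
    unfolding FD' by (rule card_filter_insert2) (use F ne in auto)
  show "degree D' i = degree D i"
    unfolding degree_def cD cD' using ord by auto
  have sumD: "total_length D = total_length F + (b - a) + (q - p)"
    using F ne ord by (simp add: total_length_def FD)
  have sumD': "total_length D' = total_length F + (a - p) + (q - b)"
    using F ne ord by (simp add: total_length_def FD')
  \<comment> \<open>The sum drops by exactly \<open>2 * (b - a)\<close>.\<close>
  show "total_length D' < total_length D"
    unfolding sumD sumD' using ord by linarith
  have diag: "{u, v} \<in> diagonals n" if "u + 1 < v" "v \<le> n + 1" "(u, v) \<noteq> (0, n + 1)" for u v
  proof -
    have "{u, v} \<notin> polygon_edges n"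
      using that polygon_edges_iff[of u v n] by auto
    moreover have "u < n + 2" "v < n + 2" "u \<noteq> v"
      using that by auto
    ultimately show ?thesis
      unfolding diagonals_def by blast
  qed
  have "D' \<subseteq> diagonals n"
    unfolding FD' using F(6) dissection ord qn by (auto simp: dissections_def intro!: diag)
  moreover have "\<not> crossing d e" if de: "d \<in> D'" "e \<in> D'" for d e
  proof -
    have FF: "\<not> crossing d e" if "d \<in> F" "e \<in> F" for d e
      using that F(6) dissection by (auto simp: dissections_def)
    have FX: "\<not> crossing d e" if "d \<in> F" "e \<in> {{p, a}, {b, q}}" for d e
      using that F(6) not_crossing_cell[OF V] mem by blast
    have XX: "\<not> crossing d e" if "d \<in> {{p, a}, {b, q}}" "e \<in> {{p, a}, {b, q}}" for d e
      using that not_crossing_self not_crossing_disjoint[of p a b q] crossing_sym ord by auto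
    consider "d \<in> F" "e \<in> F" | "d \<in> F" "e \<in> {{p, a}, {b, q}}" | "d \<in> {{p, a}, {b, q}}" "e \<in> F" |
      "d \<in> {{p, a}, {b, q}}" "e \<in> {{p, a}, {b, q}}"
      using de unfolding FD' by blast
    then show ?thesis
      by cases (use FF FX XX FX[of e d] crossing_sym[of d e] in simp_all)
  qed
  ultimately have diss: "D' \<in> dissections n"
    by (simp add: dissections_def)
  then interpret D': dissection n D'
    using n_pos by unfold_locales
  have bal: "\<And>i j. i < j \<Longrightarrow> {i, j} \<in> D \<Longrightarrow> balanced D i j" and cardD: "card D mod 3 = (n + 2) mod 3"
    using periodic three_periodic_iff by auto
  note part = inner_partial[OF V balanced_consec[OF V bal]]
  have "balanced D' i j" if ij: "i < j" "{i, j} \<in> D'" for i j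
  proof -
    have innerD: "inner D i j = card {d \<in> F. d \<subseteq> {i..j}} + of_bool ({a, b} \<subseteq> {i..j}) +
        of_bool ({p, q} \<subseteq> {i..j})"
      unfolding inner_def by (rule cD)
    have innerD': "inner D' i j = card {d \<in> F. d \<subseteq> {i..j}} + of_bool ({p, a} \<subseteq> {i..j}) +
        of_bool ({b, q} \<subseteq> {i..j})"
      unfolding inner_def by (rule cD')
    consider "{i, j} \<in> F" | "{i, j} = {p, a}" | "{i, j} = {b, q}"
      using ij(2) FD' by auto
    then show ?thesis
    proof cases
      case 1
      then have D: "{i, j} \<in> D" "(i, j) \<noteq> (a, b)"
        using F by auto
      \<comment> \<open>A surviving chord over a vertex of the cell encloses the whole cell, hence
        both old and both new chords; one over no vertex contains none of the four.\<close>
      have "inner D' i j = inner D i j"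
      proof (cases "\<exists>v\<in>V. i < v \<and> v < j")
        case True
        then have "i \<le> p" "q \<le> j"
          using chord_over_cell'[OF V D(1)] by (auto simp: p_def q_def)
        then show ?thesis
          unfolding innerD innerD' using ord by simp
      next
        case False
        then have no: "\<not> (i < v \<and> v < j)" if "v \<in> V" for v
          using that by blast
        have "\<not> {p, a} \<subseteq> {i..j}" "\<not> {b, q} \<subseteq> {i..j}" "\<not> {p, q} \<subseteq> {i..j}"
          using no[OF x(1)] no[OF y(1)] x y ord by auto
        moreover have "\<not> {a, b} \<subseteq> {i..j}"
          using no[OF mem(1)] no[OF mem(2)] D(2) ord by auto
        ultimately show ?thesis
          unfolding innerD innerD' by simp
      qed
      then show ?thesis
        using bal[OF ij(1) D(1)] by (simp add: balanced_def)
    next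
      case 2
      then have eq: "i = p" "j = a"
        using ij(1) ord by (auto simp: doubleton_eq_iff)
      \<comment> \<open>The new chord \<open>{p, a}\<close> spans the \<open>s\<close> sides before
        \<open>a\<close>, as if closing a cell with \<open>s + 1\<close> vertices.\<close>
      have "inner D p a mod 3 = (a - p + 2 * s) mod 3"
        using part[of 0 s] s2 ends by (auto simp: a_def)
      moreover have "inner D' p a = inner D p a + 1"
        using innerD innerD' ord unfolding eq by simp
      ultimately have "inner D' p a mod 3 = (a - p + 2 * s + 1) mod 3"
        by (metis mod_add_left_eq)
      also have "\<dots> = (a - p + 2) mod 3"
        using mod3_cell_iff[of "s + 1" "a - p"] s3 by simp
      finally show ?thesis
        by (simp add: balanced_def eq)
    next
      case 3
      then have eq: "i = b" "j = q"
        using ij(1) ord by (auto simp: doubleton_eq_iff)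
      \<comment> \<open>The number of sides from \<open>b\<close> to \<open>q\<close>; with
        \<open>{b, q}\<close> they bound a polygon of \<open>r + 1\<close> vertices, the
        \<open>card V - (s + 1)\<close> vertices that remain.\<close>
      define r where "r = card V - 1 - (s + 1)"
      have "inner D b q mod 3 = (q - b + 2 * r) mod 3"
        using part[of "s + 1" "card V - 1"] s2 ends by (auto simp: b_def r_def)
      moreover have "inner D' b q = inner D b q + 1"
        using innerD innerD' ord unfolding eq by simp
      ultimately have "inner D' b q mod 3 = (q - b + 2 * r + 1) mod 3"
        by (metis mod_add_left_eq)
      also have "\<dots> = (q - b + 2) mod 3"
      proof -
        have "r + 1 + (s + 1) = card V"
          using s2 by (simp add: r_def)
        then have "3 dvd r + 1 + (s + 1)"
          using card3 by simp
        then have "3 dvd r + 1"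
          using s3 dvd_add_left_iff by blast
        then show ?thesis
          using mod3_cell_iff[of "r + 1" "q - b"] by simp
      qed
      finally show ?thesis
        by (simp add: balanced_def eq)
    qed
  qed
  moreover have "card D' = card D"
    using cD[of "\<lambda>_. True"] cD'[of "\<lambda>_. True"] by simp
  ultimately have "\<forall>V\<in>cells n D'. 3 dvd card V"
    using D'.three_periodic_iff cardD by simp
  then show "D' \<in> three_periodic_dissections n"
    using diss by (simp add: three_periodic_dissections_def)
qed

lemma opening_surgery_decreases:
  assumes periodic: "\<forall>V\<in>cells n D. 3 dvd card V" and V: "V \<in> cells n D"
    and surg: "opening_surgery n D V D'"
  shows "D' \<in> three_periodic_dissections n" "degree D' i = degree D i"
    "total_length D' < total_length D"
proof -
  note C = cellD[OF V]
  obtain s c where s: "distant V s (card V - 1)" "side V s \<in> D" "base_side V \<in> D"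
      "z3_index n D (side V s) c" "z3_index n D (base_side V) c"
    and D': "D' = (D - {side V s, base_side V}) \<union>
      {{vtx V (s + 1), vtx V (card V - 1)}, {vtx V (card V - 1 + 1), vtx V s}}"
    using surg unfolding opening_surgery_def base_side_def by blast
  have s1: "s + 1 < card V"
    using s(1) by (simp add: distant_def)
  then have "s mod 3 = 2"
    using z3_index_eq_base_iff[OF V] s by blast
  moreover have "base_side V = {Min V, Max V}" "vtx V (card V - 1) = Max V"
      "vtx V (card V - 1 + 1) = Min V" "side V s = {vtx V s, vtx V (s + 1)}"
    using base_side_eq[OF C(1,2)] vtx_0[OF C(1,3)] vtx_last[OF C(1,3)] s1 by (simp_all add: side_def)
  ultimately show "D' \<in> three_periodic_dissections n" "degree D' i = degree D i"
      "total_length D' < total_length D"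
    using surgery[OF periodic V s1, of D'] s D' by (auto simp: insert_commute)
qed

end

section \<open>Uniqueness\<close>

context dissection
begin

text \<open>The position of the side is stated as a number of vertices up to \<open>i\<close>,
  because \<open>first_difference\<close> identifies that set of vertices with a cell of the other
  dissection.\<close>

lemma maximally_open_no_chord:
  assumes "maximally_open n D" "\<forall>V\<in>cells n D. 3 dvd card V" "V \<in> cells n D"
    "{Min V, Max V} \<in> D" "consec V i j" "{i, j} \<in> D"
  shows "\<not> 3 dvd card {x \<in> V. x \<le> i}"
proof
  note C = cellD[OF assms(3)]
  assume 3: "3 dvd card {x \<in> V. x \<le> i}"
  obtain s where s: "s + 1 < card V" "i = vtx V s" "j = vtx V (s + 1)"
    using consec_imp_vtx[OF C(1) assms(5)] .
  have "{x \<in> V. x \<le> i} = {x \<in> V. x < vtx V (s + 1)}"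
    using consec_iff_less[OF assms(5)] s by auto
  then have "3 dvd s + 1"
    using 3 card_below_vtx[OF C(1) s(1)] by simp
  then have mod: "s mod 3 = 2"
    by presburger
  have "3 dvd card V"
    using assms by blast
  then have "2 \<le> s" "s + 4 \<le> card V"
    using s(1) mod by presburger+
  then have "distant V s (card V - 1)"
    by (auto simp: distant_def)
  moreover obtain c where "z3_index n D (side V s) c" "z3_index n D (base_side V) c"
    using z3_index_eq_base_iff[OF assms(3) s(1)] mod by blast
  moreover have "side V s \<in> D" "base_side V \<in> D"
    using assms(4,6) s base_side_eq[OF C(1,2)] by (auto simp: side_def)
  ultimately have "\<exists>D'. opening_surgery n D V D'"
    unfolding opening_surgery_def base_side_def by blast
  then show False
    using assms(1,3) by (auto simp: maximally_open_def maximally_open_cell_def)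
qed

end

text \<open>At the first place where two dissections with equal degrees differ, one of them closes a
  chord \<open>(y, i)\<close>, while the other keeps a chord \<open>(y, w)\<close> open and opens a new one at \<open>i\<close>. The cell
  closed by the former shows that the latter has \<open>i\<close> at a position that admits an opening
  surgery.\<close>

lemma first_difference:
  assumes "dissection n D" "dissection n D'"
    and open_D: "maximally_open n D" and per: "\<forall>V\<in>cells n D. 3 dvd card V"
    and per': "\<forall>V\<in>cells n D'. 3 dvd card V"
    and deg: "\<And>i. i \<le> n + 1 \<Longrightarrow> degree D i = degree D' i"
    and agree: "\<And>a b. a < b \<Longrightarrow> b < i \<Longrightarrow> {a, b} \<in> D \<longleftrightarrow> {a, b} \<in> D'"
    and agree_i: "\<And>z. y < z \<Longrightarrow> z < i \<Longrightarrow> {z, i} \<in> D \<longleftrightarrow> {z, i} \<in> D'"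
    and yi: "y < i" "{y, i} \<in> D'" "{y, i} \<notin> D"
  shows False
proof -
  interpret A: dissection n D by fact
  interpret B: dissection n D' by fact
  note yi' = B.chordD[OF yi(2,1)]
  have card_eq: "card {x. {z, x} \<in> D} = card {x. {z, x} \<in> D'}" if "z \<le> n + 1" for z
    using deg[OF that] by (simp add: A.degree_eq B.degree_eq)
  have le: "{z, x} \<in> D \<longleftrightarrow> {z, x} \<in> D'" if "z < i" "x < i" for z x
  proof (cases z x rule: linorder_cases)
    case equal
    then show ?thesis
      using A.neighbour_neq B.neighbour_neq by blast
  qed (use agree[of z x] agree[of x z] that in \<open>auto simp: insert_commute\<close>)
  \<comment> \<open>The chords from \<open>y\<close> to points below \<open>i\<close> agree, and
    \<open>D'\<close> also has \<open>{y, i}\<close>; equal degrees at \<open>y\<close> force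
    \<open>D\<close> to have a chord beyond \<open>i\<close>. The shortest one is taken as
    \<open>{y, w}\<close>.\<close>
  have "\<exists>x>i. {y, x} \<in> D"
  proof (rule ccontr)
    assume "\<not> ?thesis"
    then have "{x. {y, x} \<in> D} \<subset> {x. {y, x} \<in> D'}"
      using le[OF yi(1)] yi by (auto simp: not_less) (metis le_neq_implies_less not_le)
    then have "card {x. {y, x} \<in> D} < card {x. {y, x} \<in> D'}"
      using psubset_card_mono B.finite_neighbours by blast
    then show False
      using card_eq[of y] yi' yi(1) by simp
  qed
  then obtain w where w: "i < w" "{y, w} \<in> D" and w_min: "\<And>x. i < x \<Longrightarrow> {y, x} \<in> D \<Longrightarrow> w \<le> x"
    using exists_least_iff[of "\<lambda>x. i < x \<and> {y, x} \<in> D"] by (metis not_le)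
  have yw: "y + 1 < w" "w \<le> n + 1" "linked n D y w"
    using A.chordD[OF w(2)] w yi(1) by auto
  \<comment> \<open>In \<open>D'\<close> the chord \<open>{y, i}\<close> blocks every chord from
    \<open>z\<close> past \<open>i\<close>, while all other chords at \<open>z\<close> agree; such a
    chord in \<open>D\<close> would make its degree at \<open>z\<close> larger.\<close>
  have none: "{z, x} \<notin> D" if z: "y < z" "z < i" "i < x" for z x
  proof
    assume zx: "{z, x} \<in> D"
    have "{x. {z, x} \<in> D'} \<subset> {x. {z, x} \<in> D}"
    proof (intro psubsetI subsetI)
      fix u assume u: "u \<in> {x. {z, x} \<in> D'}"
      have "\<not> i < u"
        using B.chord_not_crossing[OF yi(2), of z u] z u by auto
      then consider "u < i" | "u = i"
        by linarith
      then show "u \<in> {x. {z, x} \<in> D}"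
        using u le[OF z(2)] agree_i[OF z(1,2)] by cases auto
    next
      have "{z, x} \<notin> D'"
        using B.chord_not_crossing[OF yi(2), of z x] z by auto
      then show "{x. {z, x} \<in> D'} \<noteq> {x. {z, x} \<in> D}"
        using zx by blast
    qed
    then have "card {x. {z, x} \<in> D'} < card {x. {z, x} \<in> D}"
      using psubset_card_mono A.finite_neighbours by blast
    then show False
      using card_eq[of z] z yw w by simp
  qed
  define V where "V = cell_below D y w"
  define W where "W = cell_below D' y i"
  have V: "V \<in> cells n D" "Min V = y" "Max V = w"
    using A.cell_below_cell[OF yw(3,1)] by (auto simp: V_def)
  have W: "W \<in> cells n D'"
    using B.cell_below_cell[OF yi'(4,1)] by (simp add: W_def)
  have i_uncovered: "\<not> (\<exists>a b. y \<le> a \<and> a < i \<and> i < b \<and> b \<le> w \<and> {a, b} \<in> D \<and> (a, b) \<noteq> (y, w))"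
    using none w_min by (metis le_antisym le_neq_implies_less)
  then have iV: "i \<in> V"
    using yi(1) w(1) by (auto simp: V_def cell_below_def)
  \<comment> \<open>Within \<open>{y..i}\<close> the two dissections have the same chords except
    \<open>{y, i}\<close>, and that one is exempted in \<open>W\<close>. In \<open>D\<close> no
    chord below \<open>{y, w}\<close> passes over \<open>i\<close>, so visibility up to
    \<open>i\<close> is the same in both.\<close>
  have "{x \<in> V. x \<le> i} = W"
  proof (intro set_eqI iffI)
    fix x assume x: "x \<in> {x \<in> V. x \<le> i}"
    show "x \<in> W"
      unfolding W_def cell_below_def
    proof (intro CollectI conjI notI)
      assume "\<exists>a b. y \<le> a \<and> a < x \<and> x < b \<and> b \<le> i \<and> {a, b} \<in> D' \<and> (a, b) \<noteq> (y, i)"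
      then obtain a b where ab: "y \<le> a" "a < x" "x < b" "b \<le> i" "{a, b} \<in> D'" "(a, b) \<noteq> (y, i)"
        by blast
      then have "{a, b} \<in> D"
        using agree[of a b] agree_i[of a] by (cases "b = i") auto
      moreover have "b \<le> w" "(a, b) \<noteq> (y, w)"
        using ab w by auto
      ultimately show False
        using x ab unfolding V_def cell_below_def by blast
    qed (use x in \<open>auto simp: V_def cell_below_def\<close>)
  next
    fix x assume x: "x \<in> W"
    then have xi: "y \<le> x" "x \<le> i"
      by (auto simp: W_def cell_below_def)
    have "x \<in> V"
      unfolding V_def cell_below_def
    proof (intro CollectI conjI notI)
      assume "\<exists>a b. y \<le> a \<and> a < x \<and> x < b \<and> b \<le> w \<and> {a, b} \<in> D \<and> (a, b) \<noteq> (y, w)"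
      then obtain a b where ab: "y \<le> a" "a < x" "x < b" "b \<le> w" "{a, b} \<in> D" "(a, b) \<noteq> (y, w)"
        by blast
      have "b \<le> i"
        using i_uncovered ab xi by (metis le_less_trans less_le_trans not_le)
      moreover have "(a, b) \<noteq> (y, i)"
        using ab yi by auto
      moreover have "{a, b} \<in> D'"
        using agree[of a b] agree_i[of a] ab calculation by (cases "b = i") auto
      ultimately show False
        using x ab unfolding W_def cell_below_def by blast
    qed (use xi w in auto)
    then show "x \<in> {x \<in> V. x \<le> i}"
      using xi by simp
  qed
  then have 3: "3 dvd card {x \<in> V. x \<le> i}"
    using per' W by simp
  \<comment> \<open>Chords of \<open>D\<close> from \<open>i\<close> to the left end strictly
    between \<open>y\<close> and \<open>i\<close>, since \<open>{y, w}\<close> blocks anything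
    further and \<open>{y, i}\<close> is absent; these are also in \<open>D'\<close>. So the missing
    degree at \<open>i\<close> must come from the right.\<close>
  have "\<exists>u>i. {i, u} \<in> D"
  proof (rule ccontr)
    assume no: "\<not> ?thesis"
    have "{x. {i, x} \<in> D} \<subset> {x. {i, x} \<in> D'}"
    proof (intro psubsetI subsetI)
      fix u assume u: "u \<in> {x. {i, x} \<in> D}"
      then have "u < i"
        using no A.neighbour_neq[of i u] by (metis linorder_neqE_nat mem_Collect_eq)
      moreover have "\<not> u < y"
        using A.chord_not_crossing[of u i y w] u w yi(1) by (auto simp: insert_commute)
      moreover have "u \<noteq> y"
        using u yi(3) by (auto simp: insert_commute)
      ultimately show "u \<in> {x. {i, x} \<in> D'}"
        using agree_i[of u] u by (auto simp: insert_commute)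
    next
      show "{x. {i, x} \<in> D} \<noteq> {x. {i, x} \<in> D'}"
        using yi by (auto simp: insert_commute)
    qed
    then have "card {x. {i, x} \<in> D} < card {x. {i, x} \<in> D'}"
      using psubset_card_mono B.finite_neighbours by blast
    then show False
      using card_eq[of i] yi' by simp
  qed
  then obtain u where u: "i < u" "{i, u} \<in> D"
    by blast
  obtain b where b: "consec V i b"
    using consec_next[OF A.cellD(1)[OF V(1)] iV] w V by auto
  \<comment> \<open>Were the side from \<open>i\<close> a polygon edge, the chord
    \<open>{i, u}\<close> would pass over the vertex \<open>b\<close> and thus enclose the cell,
    whose least vertex is \<open>y < i\<close>.\<close>
  have "{i, b} \<in> D"
  proof (rule ccontr)
    assume "{i, b} \<notin> D"
    then have "b = i + 1"
      using A.consec_chord[OF V(1) b] by simp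
    then have "b \<in> V" "i < b" "b < u"
      using b A.chordD(1)[OF u(2,1)] by (auto simp: consec_def)
    then have "i \<le> y"
      using A.chord_over_cell'(1)[OF V(1) u(2)] V(2) by simp
    then show False
      using yi(1) by simp
  qed
  then show False
    using A.maximally_open_no_chord[OF open_D per V(1) _ b] V w 3 by simp
qed

lemma maximally_open_unique:
  assumes "n \<ge> 1" "D \<in> three_periodic_dissections n" "D' \<in> three_periodic_dissections n"
    and deg: "\<And>i. i \<le> n + 1 \<Longrightarrow> degree D i = degree D' i"
    and "maximally_open n D" "maximally_open n D'"
  shows "D = D'"
proof (rule ccontr)
  assume neq: "D \<noteq> D'"
  have diss: "dissection n D" "dissection n D'"
    and per: "\<forall>V\<in>cells n D. 3 dvd card V" "\<forall>V\<in>cells n D'. 3 dvd card V"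
    using assms by (auto simp: three_periodic_dissections_def intro!: dissection.intro)
  let ?diff = "\<lambda>a b. a < b \<and> ({a, b} \<in> D) \<noteq> ({a, b} \<in> D')"
  have "\<exists>i y. ?diff y i"
  proof -
    obtain d where "(d \<in> D) \<noteq> (d \<in> D')"
      using neq by blast
    then show ?thesis
      using dissection.chord_cases[OF diss(1)] dissection.chord_cases[OF diss(2)] by metis
  qed
  then obtain i where i: "\<exists>y. ?diff y i" and i_min: "\<And>b. b < i \<Longrightarrow> \<not> (\<exists>y. ?diff y b)"
    using exists_least_iff[of "\<lambda>i. \<exists>y. ?diff y i"] by blast
  \<comment> \<open>The least right end \<open>i\<close> and then the greatest left end: chord ends
    at \<open>i\<close> are read from the innermost outwards, which provides both agreement
    hypotheses of \<open>first_difference\<close>.\<close>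
  define y where "y = (GREATEST y. ?diff y i)"
  have y: "?diff y i"
    unfolding y_def by (rule GreatestI_ex_nat[OF i, of i]) simp
  have y_max: "z \<le> y" if "?diff z i" for z
    unfolding y_def by (rule Greatest_le_nat[of "\<lambda>y. ?diff y i", OF that, of i]) simp
  have agree: "{a, b} \<in> D \<longleftrightarrow> {a, b} \<in> D'" if "a < b" "b < i" for a b
    using i_min that by blast
  have agree_i: "{z, i} \<in> D \<longleftrightarrow> {z, i} \<in> D'" if "y < z" "z < i" for z
    using y_max[of z] that by auto
  show False
  proof (cases "{y, i} \<in> D")
    case False
    then show ?thesis
      using y first_difference[OF diss assms(5) per deg agree agree_i] by blast
  next
    case True
    then show ?thesis
      using y first_difference[OF diss(2,1) assms(6) per(2,1) deg[symmetric] agree[symmetric]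
          agree_i[symmetric]] by blast
  qed
qed

lemma same_quiddity_iff_degree:
  assumes "n \<ge> 1" "D \<in> three_periodic_dissections n" "D' \<in> three_periodic_dissections n"
  shows "quiddity n D = quiddity n D' \<longleftrightarrow> (\<forall>i\<le>n + 1. degree D i = degree D' i)"
proof -
  have "dissection n D" "dissection n D'"
    using assms by (auto simp: three_periodic_dissections_def intro!: dissection.intro)
  then show ?thesis
    by (auto simp: dissection.quiddity_eq less_Suc_eq_le simp del: upt_Suc)
qed

theorem theorem6p20:
  fixes n :: nat
  assumes "n \<ge> 1"
  shows "\<forall>K \<in> three_periodic_dissections n // same_quiddity n.
           \<exists>!D. D \<in> K \<and> maximally_open n D"
proof
  fix K assume "K \<in> three_periodic_dissections n // same_quiddity n"
  then obtain D0 where D0: "D0 \<in> three_periodic_dissections n" "K = same_quiddity n `` {D0}"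
    by (auto elim: quotientE)
  have K: "D \<in> K \<longleftrightarrow> D \<in> three_periodic_dissections n \<and> (\<forall>i\<le>n + 1. degree D i = degree D0 i)" for D
    using D0 same_quiddity_iff_degree[OF assms, of D0 D] by (auto simp: same_quiddity_def)
  have "D0 \<in> K"
    using K D0 by blast
  then obtain D where D: "D \<in> K" and least: "\<And>D'. D' \<in> K \<Longrightarrow> total_length D \<le> total_length D'"
    using ex_has_least_nat[of "\<lambda>D. D \<in> K" D0 total_length] by blast
  have per: "\<forall>V\<in>cells n D. 3 dvd card V" and "dissection n D"
    using D K assms by (auto simp: three_periodic_dissections_def intro!: dissection.intro)
  then interpret dissection n D
    by simp
  have "\<not> opening_surgery n D V D'" if V: "V \<in> cells n D" for V D'
  proof
    assume "opening_surgery n D V D'"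
    note surg = opening_surgery_decreases[OF per V this]
    have "D' \<in> K"
      using surg(1,2) D K by simp
    then show False
      using least surg(3) by (metis not_le)
  qed
  then have "maximally_open n D"
    by (simp add: maximally_open_def maximally_open_cell_def)
  moreover have "D' = D" if "D' \<in> K" "maximally_open n D'" for D'
    using maximally_open_unique[OF assms, of D' D] that D K \<open>maximally_open n D\<close> by simp
  ultimately show "\<exists>!D. D \<in> K \<and> maximally_open n D"
    using D by blast
qed

end
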